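(* Let $\Lambda$ be a finite strongly connected $k$-graph with vertex matrices $A_1,\dots,A_k$ whose spectral radii satisfy $\rho_i>1$ for all $1\le i\le k$, and let $\delta\in(0,1)$. Then the Perron-Frobenius measure $\mu$ on $\partial\mathcal{B}_\Lambda$ has the volume doubling property with respect to the ultrametric $d_{w_\delta}$: there is a constant $c>0$ such that $$\mu(B(x,2r))\le c\,\mu(B(x,r))\quad\text{for all }x\in\partial\mathcal{B}_\Lambda\text{ and all }r>0,$$ where $B(x,r)=\{y\in\partial\mathcal{B}_\Lambda: d_{w_\delta}(x,y)<r\}$.
   Context: **$k$-graphs.** $\mathbb{N}=\{0,1,2,\dots\}$. A $k$-graph is a small category $\Lambda$ with a functor $d:\Lambda\to\mathbb{N}^k$ such that whenever $d(\lambda)=m+n$ there are unique $\alpha,\beta\in\Lambda$ with $\lambda=\alpha\beta$, $d(\alpha)=m$, $d(\beta)=n$. $\Lambda^n=d^{-1}(n)$, and $\Lambda^0$ is the set of vertices (objects); $r,s$ denote range and source. $\Lambda$ is finite if every $\Lambda^n$ is finite, and strongly connected if for all $v,w\in\Lambda^0$ there is a morphism with range $v$ and source $w$. The vertex matrices $A_i\in M_{\Lambda^0}(\mathbb{N})$, $A_i(v,w)=|\{\lambda\in\Lambda^{e_i}:r(\lambda)=v,\ s(\lambda)=w\}|$ ($e_i$ the $i$-th standard basis vector), commute. $\rho_i$ is the spectral radius of $A_i$. $\kappa^\Lambda\in(0,\infty)^{\Lambda^0}$ is the unique positive vector with $\sum_v\kappa^\Lambda_v=1$ and $A_i\kappa^\Lambda=\rho_i\kappa^\Lambda$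 for all $i$ (Perron-Frobenius eigenvector). **Stationary $k$-Bratteli diagram $\mathcal{B}_\Lambda$.** It has vertex levels $V_0,V_1,\dots$, each a copy of $\Lambda^0$. For $n\ge1$ the $n$-th edge level consists of edges with source in $V_n$ and range in $V_{n-1}$: if $n\equiv i \pmod k$ with $1\le i\le k$, there are $A_i(p,q)$ edges with range $p\in V_{n-1}$ and source $q\in V_n$. $F\mathcal{B}_\Lambda$ is the set of finite paths $\eta=\eta_1\cdots\eta_n$ ($\eta_j$ in the $j$-th edge level, $s(\eta_j)=r(\eta_{j+1})$) starting with range in $V_0$, of length $|\eta|=n\ge0$; paths of length $0$ are the vertices of $V_0$. $\partial\mathcal{B}_\Lambda$ is the set of infinite paths $x=x_1x_2\cdots$ of the same kind, and $[\eta]\subseteq\partial\mathcal{B}_\Lambda$ is the cylinder set of infinite paths with initial segment $\eta$; cylinder sets generate the topology. $x\wedge y$ is the longest common initial sub-path of $x\ne y$, and $x\wedge y=\emptyset$ if $r(x)\neq r(y)$. **Measure, weight, metric.** For $|\eta|=qk+t$ with $0\le t\le k-1$, $$\mu[\eta]=(\rho_1\cdots\rho_t)^{-(q+1)}(\rho_{t+1}\cdots\rho_k)^{-q}\kappa^\Lambda_{s(\eta)},\qquad w_\delta(\eta)=\big(\rho_1^{q+1}\cdots\rho_t^{q+1}\rho_{t+1}^q\cdots\rho_k^q\big)^{-1/\delta}\kappa^\Lambda_{s(\eta)};$$ $\mu$ extends to a Borel probability measure on $\partial\mathcal{B}_\Lambda$ (the Perron-Frobenius measure). The ultrametric $d_{w_\delta}$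 is $d_{w_\delta}(x,x)=0$, $d_{w_\delta}(x,y)=1$ if $x\wedge y=\emptyset$, and $d_{w_\delta}(x,y)=w_\delta(x\wedge y)$ otherwise. *)

theory Defs
  imports "HOL-Probability.Probability" "Jordan_Normal_Form.Spectral_Radius"
begin

section \<open>Higher-rank graphs\<close>

text \<open>
  A small category equipped with a degree map.  Categories are presented by their morphisms only:
  an object is identified with its identity morphism, so that \<open>range_of\<close> and \<open>source_of\<close> take
  values in \<open>mor\<close>.  The composite \<open>comp \<alpha> \<beta>\<close> is meaningful when
  \<open>source_of \<alpha> = range_of \<beta>\<close>.  An element of \<open>\<nat>\<^sup>k\<close> is a function \<open>nat \<Rightarrow> nat\<close>
  vanishing outside \<open>{1..k}\<close>.
\<close>

record 'a graded_category =
  mor :: "'a set"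
  comp :: "'a \<Rightarrow> 'a \<Rightarrow> 'a"
  range_of :: "'a \<Rightarrow> 'a"
  source_of :: "'a \<Rightarrow> 'a"
  deg :: "'a \<Rightarrow> nat \<Rightarrow> nat"

definition multidegrees :: "nat \<Rightarrow> (nat \<Rightarrow> nat) set" where
  "multidegrees k = {n. \<forall>i. i \<notin> {1..k} \<longrightarrow> n i = 0}"

definition unit_degree :: "nat \<Rightarrow> nat \<Rightarrow> nat" where
  "unit_degree i = (\<lambda>j. if j = i then 1 else 0)"

definition small_category :: "('a, 'b) graded_category_scheme \<Rightarrow> bool" where
  "small_category \<Lambda> \<longleftrightarrow>
     (\<forall>f\<in>mor \<Lambda>. range_of \<Lambda> f \<in> mor \<Lambda> \<and> source_of \<Lambda> f \<in> mor \<Lambda>) \<and>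
     (\<forall>f\<in>mor \<Lambda>. range_of \<Lambda> (range_of \<Lambda> f) = range_of \<Lambda> f \<and>
                 source_of \<Lambda> (range_of \<Lambda> f) = range_of \<Lambda> f \<and>
                 range_of \<Lambda> (source_of \<Lambda> f) = source_of \<Lambda> f \<and>
                 source_of \<Lambda> (source_of \<Lambda> f) = source_of \<Lambda> f) \<and>
     (\<forall>f\<in>mor \<Lambda>. \<forall>g\<in>mor \<Lambda>. source_of \<Lambda> f = range_of \<Lambda> g \<longrightarrow>
        comp \<Lambda> f g \<in> mor \<Lambda> \<and>
        range_of \<Lambda> (comp \<Lambda> f g) = range_of \<Lambda> f \<and>
        source_of \<Lambda> (comp \<Lambda> f g) = source_of \<Lambda> g) \<and>
     (\<forall>f\<in>mor \<Lambda>. \<forall>g\<in>mor \<Lambda>. \<forall>h\<in>mor \<Lambda>.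
        source_of \<Lambda> f = range_of \<Lambda> g \<longrightarrow> source_of \<Lambda> g = range_of \<Lambda> h \<longrightarrow>
        comp \<Lambda> (comp \<Lambda> f g) h = comp \<Lambda> f (comp \<Lambda> g h)) \<and>
     (\<forall>f\<in>mor \<Lambda>. comp \<Lambda> (range_of \<Lambda> f) f = f \<and> comp \<Lambda> f (source_of \<Lambda> f) = f)"

text \<open>
  Functoriality of \<open>deg\<close>, where \<open>\<nat>\<^sup>k\<close> is regarded as a category with one object; that identities
  have degree 0 is a consequence of additivity.
\<close>

definition degree_functor :: "nat \<Rightarrow> ('a, 'b) graded_category_scheme \<Rightarrow> bool" where
  "degree_functor k \<Lambda> \<longleftrightarrow>
     (\<forall>f\<in>mor \<Lambda>. deg \<Lambda> f \<in> multidegrees k) \<and>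
     (\<forall>f\<in>mor \<Lambda>. \<forall>g\<in>mor \<Lambda>. source_of \<Lambda> f = range_of \<Lambda> g \<longrightarrow>
        deg \<Lambda> (comp \<Lambda> f g) = (\<lambda>i. deg \<Lambda> f i + deg \<Lambda> g i))"

definition factorization_property :: "nat \<Rightarrow> ('a, 'b) graded_category_scheme \<Rightarrow> bool" where
  "factorization_property k \<Lambda> \<longleftrightarrow>
     (\<forall>f\<in>mor \<Lambda>. \<forall>m\<in>multidegrees k. \<forall>n\<in>multidegrees k.
        deg \<Lambda> f = (\<lambda>i. m i + n i) \<longrightarrow>
        (\<exists>!(\<alpha>, \<beta>). \<alpha> \<in> mor \<Lambda> \<and> \<beta> \<in> mor \<Lambda> \<and> source_of \<Lambda> \<alpha> = range_of \<Lambda> \<beta> \<and>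
           f = comp \<Lambda> \<alpha> \<beta> \<and> deg \<Lambda> \<alpha> = m \<and> deg \<Lambda> \<beta> = n))"

definition k_graph :: "nat \<Rightarrow> ('a, 'b) graded_category_scheme \<Rightarrow> bool" where
  "k_graph k \<Lambda> \<longleftrightarrow> small_category \<Lambda> \<and> degree_functor k \<Lambda> \<and> factorization_property k \<Lambda>"

definition mor_of_degree :: "('a, 'b) graded_category_scheme \<Rightarrow> (nat \<Rightarrow> nat) \<Rightarrow> 'a set" where
  "mor_of_degree \<Lambda> n = {f \<in> mor \<Lambda>. deg \<Lambda> f = n}"

definition vertices :: "('a, 'b) graded_category_scheme \<Rightarrow> 'a set" where
  "vertices \<Lambda> = mor_of_degree \<Lambda> (\<lambda>i. 0)"

lemma vertices_eq_identities:
  assumes "k_graph k \<Lambda>"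
  shows "vertices \<Lambda> = {f \<in> mor \<Lambda>. range_of \<Lambda> f = f}"
    and "vertices \<Lambda> = {f \<in> mor \<Lambda>. source_of \<Lambda> f = f}"
proof -
  from assms have cat: "small_category \<Lambda>" and fn: "degree_functor k \<Lambda>"
    and fac: "factorization_property k \<Lambda>"
    by (auto simp: k_graph_def)
  have idr: "range_of \<Lambda> f \<in> mor \<Lambda>" "source_of \<Lambda> (range_of \<Lambda> f) = range_of \<Lambda> f"
    "range_of \<Lambda> (range_of \<Lambda> f) = range_of \<Lambda> f" "comp \<Lambda> (range_of \<Lambda> f) f = f"
    "source_of \<Lambda> f \<in> mor \<Lambda>" "range_of \<Lambda> (source_of \<Lambda> f) = source_of \<Lambda> f"
    "source_of \<Lambda> (source_of \<Lambda> f) = source_of \<Lambda> f" "comp \<Lambda> f (source_of \<Lambda> f) = f"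
    if "f \<in> mor \<Lambda>" for f
    using cat that by (auto simp: small_category_def)
  have deg0: "deg \<Lambda> f = (\<lambda>i. 0)"
    if f: "f \<in> mor \<Lambda>" and s: "source_of \<Lambda> f = f" and r: "range_of \<Lambda> f = f" for f
  proof -
    have "deg \<Lambda> (comp \<Lambda> f f) = (\<lambda>i. deg \<Lambda> f i + deg \<Lambda> f i)"
      using fn f s r by (auto simp: degree_functor_def)
    moreover have "comp \<Lambda> f f = f"
      using idr(4)[OF f] r by simp
    ultimately have "\<And>i. deg \<Lambda> f i = deg \<Lambda> f i + deg \<Lambda> f i"
      by (metis (no_types))
    then show ?thesis by (simp add: fun_eq_iff)
  qed
  have deg_r: "deg \<Lambda> (range_of \<Lambda> f) = (\<lambda>i. 0)" "deg \<Lambda> (source_of \<Lambda> f) = (\<lambda>i. 0)"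
    if "f \<in> mor \<Lambda>" for f
    using deg0 idr that by auto
  have ident: "range_of \<Lambda> f = f \<and> source_of \<Lambda> f = f"
    if f: "f \<in> mor \<Lambda>" and d: "deg \<Lambda> f = (\<lambda>i. 0)" for f
  proof -
    let ?P = "\<lambda>(\<alpha>, \<beta>). \<alpha> \<in> mor \<Lambda> \<and> \<beta> \<in> mor \<Lambda> \<and> source_of \<Lambda> \<alpha> = range_of \<Lambda> \<beta> \<and>
           f = comp \<Lambda> \<alpha> \<beta> \<and> deg \<Lambda> \<alpha> = (\<lambda>i. 0) \<and> deg \<Lambda> \<beta> = (\<lambda>i. 0)"
    have zero: "(\<lambda>i. 0) \<in> multidegrees k"
      by (simp add: multidegrees_def)
    have sum: "deg \<Lambda> f = (\<lambda>i. (\<lambda>i. 0) i + (\<lambda>i. 0) i)"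
      using d by simp
    have "\<exists>!p. ?P p"
      using fac[unfolded factorization_property_def, rule_format, OF f zero zero sum] .
    moreover have "?P (range_of \<Lambda> f, f)" "?P (f, source_of \<Lambda> f)"
      using idr[OF f] deg_r[OF f] f d by auto
    ultimately show ?thesis by blast
  qed
  show "vertices \<Lambda> = {f \<in> mor \<Lambda>. range_of \<Lambda> f = f}"
    using ident deg_r(1) by (fastforce simp: vertices_def mor_of_degree_def)
  show "vertices \<Lambda> = {f \<in> mor \<Lambda>. source_of \<Lambda> f = f}"
    using ident deg_r(2) by (fastforce simp: vertices_def mor_of_degree_def)
qed

definition finite_k_graph :: "nat \<Rightarrow> ('a, 'b) graded_category_scheme \<Rightarrow> bool" where
  "finite_k_graph k \<Lambda> \<longleftrightarrow> (\<forall>n\<in>multidegrees k. finite (mor_of_degree \<Lambda> n))"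

definition strongly_connected :: "('a, 'b) graded_category_scheme \<Rightarrow> bool" where
  "strongly_connected \<Lambda> \<longleftrightarrow>
     (\<forall>v\<in>vertices \<Lambda>. \<forall>w\<in>vertices \<Lambda>. \<exists>f\<in>mor \<Lambda>. range_of \<Lambda> f = v \<and> source_of \<Lambda> f = w)"

definition vertex_matrix :: "('a, 'b) graded_category_scheme \<Rightarrow> nat \<Rightarrow> 'a \<Rightarrow> 'a \<Rightarrow> nat" where
  "vertex_matrix \<Lambda> i v w =
     card {f \<in> mor_of_degree \<Lambda> (unit_degree i). range_of \<Lambda> f = v \<and> source_of \<Lambda> f = w}"

text \<open>
  The library's spectral radius is defined for matrices indexed by \<open>{0..<n}\<close>, so the rows and
  columns of the vertex matrix are numbered along the enumeration \<open>from_nat_into (vertices \<Lambda>)\<close>,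
  which maps \<open>{0..<card (vertices \<Lambda>)}\<close> bijectively onto the finite set \<open>vertices \<Lambda>\<close>.
\<close>

definition rho :: "('a, 'b) graded_category_scheme \<Rightarrow> nat \<Rightarrow> real" where
  "rho \<Lambda> i = spectral_radius
     (Matrix.mat (card (vertices \<Lambda>)) (card (vertices \<Lambda>))
        (\<lambda>(a, b). complex_of_nat (vertex_matrix \<Lambda> i
           (from_nat_into (vertices \<Lambda>) a) (from_nat_into (vertices \<Lambda>) b))))"

definition is_PF_eigenvector ::
    "nat \<Rightarrow> ('a, 'b) graded_category_scheme \<Rightarrow> ('a \<Rightarrow> real) \<Rightarrow> bool" where
  "is_PF_eigenvector k \<Lambda> x \<longleftrightarrow>
     (\<forall>v. v \<notin> vertices \<Lambda> \<longrightarrow> x v = 0) \<and>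
     (\<forall>v\<in>vertices \<Lambda>. 0 < x v) \<and>
     (\<Sum>v\<in>vertices \<Lambda>. x v) = 1 \<and>
     (\<forall>i\<in>{1..k}. \<forall>v\<in>vertices \<Lambda>.
        (\<Sum>w\<in>vertices \<Lambda>. real (vertex_matrix \<Lambda> i v w) * x w) = rho \<Lambda> i * x v)"

definition kappa :: "nat \<Rightarrow> ('a, 'b) graded_category_scheme \<Rightarrow> 'a \<Rightarrow> real" where
  "kappa k \<Lambda> = (THE x. is_PF_eigenvector k \<Lambda> x)"


section \<open>The stationary Bratteli diagram\<close>

text \<open>
  Edges are triples of range, source and a number distinguishing parallel edges.  The vertices of
  each level are the elements of \<open>vertices \<Lambda>\<close>; the level of an edge is given by its position in a
  path.  For \<open>n \<ge> 1\<close>, \<open>(n - 1) mod k + 1\<close> is the index in \<open>{1..k}\<close> congruent to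
  \<open>n\<close> modulo \<open>k\<close>.
\<close>

type_synonym 'a edge = "'a \<times> 'a \<times> nat"

definition edge_range :: "'a edge \<Rightarrow> 'a" where
  "edge_range e = fst e"

definition edge_source :: "'a edge \<Rightarrow> 'a" where
  "edge_source e = fst (snd e)"

definition edge_level ::
    "nat \<Rightarrow> ('a, 'b) graded_category_scheme \<Rightarrow> nat \<Rightarrow> 'a edge set" where
  "edge_level k \<Lambda> n = {(p, q, m). p \<in> vertices \<Lambda> \<and> q \<in> vertices \<Lambda> \<and>
     m < vertex_matrix \<Lambda> ((n - 1) mod k + 1) p q}"

text \<open>
  A finite path is a pair of its range in level 0 and its list of edges.  Lists and sequences of
  edges are indexed from 0, so the edge with index \<open>j\<close> belongs to the edge level \<open>j + 1\<close>.
\<close>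

type_synonym 'a fpath = "'a \<times> 'a edge list"

definition finite_paths ::
    "nat \<Rightarrow> ('a, 'b) graded_category_scheme \<Rightarrow> 'a fpath set" where
  "finite_paths k \<Lambda> = {(v, es). v \<in> vertices \<Lambda> \<and>
     (\<forall>j<length es. es ! j \<in> edge_level k \<Lambda> (Suc j)) \<and>
     (es \<noteq> [] \<longrightarrow> edge_range (hd es) = v) \<and>
     (\<forall>j. Suc j < length es \<longrightarrow> edge_source (es ! j) = edge_range (es ! Suc j))}"

definition path_length :: "'a fpath \<Rightarrow> nat" where
  "path_length \<eta> = length (snd \<eta>)"

definition path_source :: "'a fpath \<Rightarrow> 'a" where
  "path_source \<eta> = (if snd \<eta> = [] then fst \<eta> else edge_source (last (snd \<eta>)))"

definition infinite_paths ::
    "nat \<Rightarrow> ('a, 'b) graded_category_scheme \<Rightarrow> (nat \<Rightarrow> 'a edge) set" where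
  "infinite_paths k \<Lambda> = {x. \<forall>j. x j \<in> edge_level k \<Lambda> (Suc j) \<and>
     edge_source (x j) = edge_range (x (Suc j))}"

definition initial_segment :: "(nat \<Rightarrow> 'a edge) \<Rightarrow> nat \<Rightarrow> 'a fpath" where
  "initial_segment x n = (edge_range (x 0), map x [0..<n])"

definition cylinder ::
    "nat \<Rightarrow> ('a, 'b) graded_category_scheme \<Rightarrow> 'a fpath \<Rightarrow> (nat \<Rightarrow> 'a edge) set" where
  "cylinder k \<Lambda> \<eta> = {x \<in> infinite_paths k \<Lambda>. initial_segment x (path_length \<eta>) = \<eta>}"

definition path_topology ::
    "nat \<Rightarrow> ('a, 'b) graded_category_scheme \<Rightarrow> (nat \<Rightarrow> 'a edge) topology" where
  "path_topology k \<Lambda> = topology_generated_by (cylinder k \<Lambda> ` finite_paths k \<Lambda>)"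

text \<open>\<open>None\<close> stands for the value \<open>\<emptyset>\<close> of \<open>x \<and> y\<close>; the definition is used only for \<open>x \<noteq> y\<close>.\<close>

definition meet :: "(nat \<Rightarrow> 'a edge) \<Rightarrow> (nat \<Rightarrow> 'a edge) \<Rightarrow> 'a fpath option" where
  "meet x y =
     (if edge_range (x 0) \<noteq> edge_range (y 0) then None
      else Some (initial_segment x
        (GREATEST n. initial_segment x n = initial_segment y n)))"


section \<open>Perron--Frobenius measure, weight and metric\<close>

text \<open>For \<open>n = q k + t\<close> with \<open>0 \<le> t < k\<close>: the product
  \<open>(\<rho>\<^sub>1 \<cdots> \<rho>\<^sub>t)\<^sup>q\<^sup>+\<^sup>1 (\<rho>\<^sub>t\<^sub>+\<^sub>1 \<cdots> \<rho>\<^sub>k)\<^sup>q\<close>.\<close>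

definition rho_product :: "nat \<Rightarrow> ('a, 'b) graded_category_scheme \<Rightarrow> nat \<Rightarrow> real" where
  "rho_product k \<Lambda> n = (let q = n div k; t = n mod k in
     (\<Prod>i\<in>{1..t}. rho \<Lambda> i ^ (q + 1)) * (\<Prod>i\<in>{t+1..k}. rho \<Lambda> i ^ q))"

definition is_PF_measure ::
    "nat \<Rightarrow> ('a, 'b) graded_category_scheme \<Rightarrow> (nat \<Rightarrow> 'a edge) measure \<Rightarrow> bool" where
  "is_PF_measure k \<Lambda> M \<longleftrightarrow>
     space M = infinite_paths k \<Lambda> \<and>
     sets M = sigma_sets (infinite_paths k \<Lambda>) {U. openin (path_topology k \<Lambda>) U} \<and>
     prob_space M \<and>
     (\<forall>\<eta>\<in>finite_paths k \<Lambda>.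
        measure M (cylinder k \<Lambda> \<eta>) =
          inverse (rho_product k \<Lambda> (path_length \<eta>)) * kappa k \<Lambda> (path_source \<eta>))"

definition PF_measure ::
    "nat \<Rightarrow> ('a, 'b) graded_category_scheme \<Rightarrow> (nat \<Rightarrow> 'a edge) measure" where
  "PF_measure k \<Lambda> = (THE M. is_PF_measure k \<Lambda> M)"

definition weight ::
    "nat \<Rightarrow> ('a, 'b) graded_category_scheme \<Rightarrow> real \<Rightarrow> 'a fpath \<Rightarrow> real" where
  "weight k \<Lambda> \<delta> \<eta> =
     rho_product k \<Lambda> (path_length \<eta>) powr (- 1 / \<delta>) * kappa k \<Lambda> (path_source \<eta>)"

definition path_dist ::
    "nat \<Rightarrow> ('a, 'b) graded_category_scheme \<Rightarrow> real \<Rightarrow>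
     (nat \<Rightarrow> 'a edge) \<Rightarrow> (nat \<Rightarrow> 'a edge) \<Rightarrow> real" where
  "path_dist k \<Lambda> \<delta> x y =
     (if x = y then 0
      else case meet x y of None \<Rightarrow> 1 | Some \<eta> \<Rightarrow> weight k \<Lambda> \<delta> \<eta>)"

definition path_ball ::
    "nat \<Rightarrow> ('a, 'b) graded_category_scheme \<Rightarrow> real \<Rightarrow>
     (nat \<Rightarrow> 'a edge) \<Rightarrow> real \<Rightarrow> (nat \<Rightarrow> 'a edge) set" where
  "path_ball k \<Lambda> \<delta> x r = {y \<in> infinite_paths k \<Lambda>. path_dist k \<Lambda> \<delta> x y < r}"

end

(*
  The powers of 1 + A_1 + ... + A_k are eventually entrywise positive and commute with every A_i.
  A positive operator K has a positive eigenvector (maximise min_v (KKx)_v / (Kx)_v over the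
  simplex), unique up to scaling, so it is a common eigenvector of the A_i, and the eigenvalue of
  a positive eigenvector of A_i must be rho_i.  This makes kappa well defined.  The measure mu is
  the law of a random path built from independent choices: edge n + 1 leads from p to q with
  probability kappa_q / (rho_i kappa_p).

  Writing P_n for the product of the first n of the rho's (repeated cyclically), the ball of
  radius r around x contains the cylinder of x|n as soon as P_n^(-1/delta) < r; if r <= 1, it lies in
  the cylinder of x|m for the least m with P_m^(-1/delta) min(kappa) < r.  As mu of the cylinder of x|n is
  comparable with 1 / P_n, this gives a r^delta <= mu(B(x,r)) <= b r^delta for 0 < r <= 1.
*)

theory Submission
  imports Defs
begin

text \<open>A single \<open>A_i\<close> may be reducible: strong connectivity only makes the union
  of the supports of all \<open>A_i\<close> connected. Classical Perron-Frobenius theory therefore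
  does not apply to the matrices one by one, and positivity has to be extracted from an operator
  that mixes them. Both \<open>kappa\<close> and \<open>PF_measure\<close> are definite
  descriptions, so nothing is known about either before existence and uniqueness are proved. A
  Markov chain is read off from one product space by giving every pair of step and vertex its own
  coordinate. Each step reads a coordinate with a new step number, so no coordinate is read twice
  and probabilities multiply; no premeasure on cylinders has to be extended by hand. The exponent
  works out because \<open>(P_n powr (-1/\<delta>)) powr \<delta>\<close> is \<open>1 / P_n\<close>,
  the mass of a level-n cylinder up to a factor \<open>kappa\<close>. In the bounds,
  \<open>b = \<kappa>_min powr (-\<delta>)\<close> pays for the factor \<open>kappa\<close> in the
  weights, while \<open>a = \<kappa>_min / \<rho>_max\<close> pays for the factor
  \<open>kappa\<close> in the measure and for overshooting by one level. Radii above 1 are harmless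
  since all distances are at most 1.\<close>

section \<open>Common positive eigenvectors of commuting nonnegative matrices\<close>

lemma continuous_on_Min_image:
  fixes f :: "'i \<Rightarrow> 'b::topological_space \<Rightarrow> real"
  assumes "finite I" "I \<noteq> {}" "\<And>i. i \<in> I \<Longrightarrow> continuous_on S (f i)"
  shows "continuous_on S (\<lambda>x. Min ((\<lambda>i. f i x) ` I))"
  using assms
proof (induction I rule: finite_ne_induct)
  case (insert i I)
  then have "(\<lambda>x. Min ((\<lambda>i. f i x) ` insert i I)) = (\<lambda>x. min (f i x) (Min ((\<lambda>i. f i x) ` I)))"
    by (simp add: fun_eq_iff)
  then show ?case using insert by (simp add: continuous_on_min)
qed simp

text \<open>The type \<open>'v\<close> may be infinite, so the simplex sits in a product over all of
  \<open>'v\<close> with the factors off \<open>V\<close> pinned to \<open>{0}\<close>. Tychonoff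
  makes this box compact, and the sum condition is closed because \<open>V\<close> is
  finite.\<close>

lemma compact_simplex:
  fixes V :: "'v set"
  assumes "finite V"
  shows "compact {x :: 'v \<Rightarrow> real.
    (\<forall>v. v \<notin> V \<longrightarrow> x v = 0) \<and> (\<forall>v\<in>V. 0 \<le> x v) \<and> (\<Sum>v\<in>V. x v) = 1}" (is "compact ?S")
proof -
  define C where "C = (\<Pi>\<^sub>E v\<in>UNIV. if v \<in> V then {0..1::real} else {0})"
  have "compactin (product_topology (\<lambda>i. euclidean) UNIV) C"
    unfolding C_def compactin_PiE by auto
  then have "compact C" by (simp add: euclidean_product_topology)
  moreover have "closed {x :: 'v \<Rightarrow> real. (\<Sum>v\<in>V. x v) = 1}"
    by (intro closed_Collect_eq continuous_intros continuous_on_product_coordinates)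
  ultimately have "compact (C \<inter> {x. (\<Sum>v\<in>V. x v) = 1})" by blast
  moreover have "?S = C \<inter> {x. (\<Sum>v\<in>V. x v) = 1}"
  proof (intro equalityI subsetI)
    fix x assume x: "x \<in> ?S"
    then have "x v \<le> 1" if "v \<in> V" for v
      using member_le_sum[of v V x] that assms by auto
    then show "x \<in> C \<inter> {x. (\<Sum>v\<in>V. x v) = 1}"
      using x by (auto simp: C_def PiE_iff)
  next
    fix x assume x: "x \<in> C \<inter> {x. (\<Sum>v\<in>V. x v) = 1}"
    then have "x v \<in> (if v \<in> V then {0..1} else {0})" for v
      by (auto simp: C_def PiE_iff)
    then have "(v \<notin> V \<longrightarrow> x v = 0) \<and> (v \<in> V \<longrightarrow> 0 \<le> x v)" for v
      by (metis atLeastAtMost_iff singletonD)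
    with x show "x \<in> ?S" by blast
  qed
  ultimately show ?thesis by simp
qed

text \<open>The Collatz-Wielandt quotient is taken at \<open>K x\<close> instead of
  \<open>x\<close>: on the boundary of the simplex \<open>x\<close> has zeros, but
  \<open>K x\<close> is positive on \<open>V\<close>, so \<open>g\<close> is continuous on the
  compact set \<open>S\<close>. At a maximiser, \<open>z = K y - g x * y\<close> with
  \<open>y = K x\<close> is nonnegative; one positive entry of \<open>z\<close> would make
  \<open>K z\<close> positive everywhere and all quotients at \<open>y\<close> strictly larger than
  \<open>g x\<close>.\<close>

lemma strictly_positive_operator_eigenvector:
  fixes K :: "('v \<Rightarrow> real) \<Rightarrow> 'v \<Rightarrow> real"
  assumes fin: "finite V" and ne: "V \<noteq> {}"
    and lin: "\<And>a b f g. K (\<lambda>v. a * f v + b * g v) = (\<lambda>v. a * K f v + b * K g v)"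
    and cont: "continuous_on UNIV K"
    and supp: "\<And>f v. v \<notin> V \<Longrightarrow> K f v = 0"
    and pos: "\<And>f v w. \<lbrakk>\<forall>u\<in>V. 0 \<le> f u; w \<in> V; 0 < f w; v \<in> V\<rbrakk> \<Longrightarrow> 0 < K f v"
  shows "\<exists>x c. (\<forall>v\<in>V. 0 < x v) \<and> K x = (\<lambda>v. c * x v)"
proof -
  define S :: "('v \<Rightarrow> real) set" where
    "S = {x. (\<forall>v. v \<notin> V \<longrightarrow> x v = 0) \<and> (\<forall>v\<in>V. 0 \<le> x v) \<and> (\<Sum>v\<in>V. x v) = 1}"
  define g where "g x = Min ((\<lambda>v. K (K x) v / K x v) ` V)" for x
  have Kpos: "0 < K x v" if "x \<in> S" "v \<in> V" for x v
  proof -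
    have "\<exists>w\<in>V. 0 < x w"
    proof (rule ccontr)
      assume "\<not> ?thesis"
      then have "(\<Sum>v\<in>V. x v) \<le> 0" by (intro sum_nonpos) auto
      then show False using that by (auto simp: S_def)
    qed
    then show ?thesis using pos that by (auto simp: S_def)
  qed
  obtain v0 where v0: "v0 \<in> V" using ne by blast
  then have "(\<lambda>v. if v = v0 then 1 else 0) \<in> S"
    using fin by (auto simp: S_def)
  moreover have "compact S" unfolding S_def by (rule compact_simplex[OF fin])
  moreover have "continuous_on S g"
    unfolding g_def
  proof (intro continuous_on_Min_image fin ne continuous_on_divide)
    fix v assume "v \<in> V"
    have 1: "continuous_on UNIV (\<lambda>x. K x v)"
      using cont by (rule continuous_on_product_then_coordinatewise)
    then show "continuous_on S (\<lambda>x. K x v)" by (rule continuous_on_subset) simp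
    have "continuous_on UNIV (\<lambda>x. K (K x) v)"
      using continuous_on_compose2[OF 1 cont] by simp
    then show "continuous_on S (\<lambda>x. K (K x) v)" by (rule continuous_on_subset) simp
    show "\<forall>x\<in>S. K x v \<noteq> 0" using Kpos \<open>v \<in> V\<close> by fastforce
  qed
  ultimately obtain x where x: "x \<in> S" and max: "\<And>y. y \<in> S \<Longrightarrow> g y \<le> g x"
    using continuous_attains_sup[of S g] by blast
  define y where "y = K x"
  define z where "z v = K y v - g x * y v" for v
  have y: "0 < y v" if "v \<in> V" for v using Kpos x that by (simp add: y_def)
  have z: "0 \<le> z v" if "v \<in> V" for v
  proof -
    have "g x \<le> K y v / y v"
      unfolding g_def y_def using fin that by (intro Min_le) auto
    then show ?thesis using y[OF that] by (simp add: z_def field_simps)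
  qed
  have "z w = 0" if w: "w \<in> V" for w
  proof (rule ccontr)
    assume "z w \<noteq> 0"
    then have zw: "0 < z w" using z[OF w] by simp
    have Ky: "0 < K y v" if "v \<in> V" for v
      using pos[of y w v] y w that by (auto intro: less_imp_le)
    have "z = (\<lambda>v. 1 * K y v + (- g x) * y v)" by (auto simp: z_def)
    then have Kz: "K z = (\<lambda>v. 1 * K (K y) v + (- g x) * K y v)" by (simp only: lin)
    \<comment> \<open>Otherwise \<open>y\<close>, rescaled into the simplex, would have a larger value of \<open>g\<close>.\<close>
    have less: "g x < K (K y) v / K y v" if "v \<in> V" for v
      using pos[of z w v] z w zw that Ky[OF that] by (simp add: Kz field_simps)
    define s where "s = (\<Sum>v\<in>V. y v)"
    have s: "0 < s" unfolding s_def using fin ne y by (intro sum_pos) auto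
    define y' where "y' v = (1 / s) * y v" for v
    have K': "K (\<lambda>v. (1 / s) * f v) = (\<lambda>v. (1 / s) * K f v)" for f
      using lin[of "1 / s" f 0 f] by simp
    have Ky': "K y' = (\<lambda>v. (1 / s) * K y v)" unfolding y'_def[abs_def] by (rule K')
    have KKy': "K (K y') = (\<lambda>v. (1 / s) * K (K y) v)" unfolding Ky' by (rule K')
    have "K (K y') v / K y' v = K (K y) v / K y v" for v
      unfolding KKy' unfolding Ky' using s by simp
    then have "g y' = Min ((\<lambda>v. K (K y) v / K y v) ` V)" by (simp add: g_def)
    then have "g x < g y'" using fin ne less by simp
    moreover have "(\<Sum>v\<in>V. y' v) = 1"
      using s by (simp add: y'_def sum_divide_distrib[symmetric] s_def[symmetric])
    then have "y' \<in> S" using y s supp by (auto simp: S_def y'_def y_def less_imp_le)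
    then have "g y' \<le> g x" by (rule max)
    ultimately show False by simp
  qed
  then have "K y v = g x * y v" for v
    using supp[of v] by (cases "v \<in> V") (auto simp: z_def y_def)
  then show ?thesis using y by blast
qed

text \<open>Take the largest multiple of \<open>x\<close> below \<open>y\<close>; it meets
  \<open>y\<close> at the vertex where \<open>y v / x v\<close> is smallest. Existence and
  uniqueness of eigenvectors both follow by showing that the nonnegative difference, having one
  zero, vanishes on all of \<open>V\<close>.\<close>

lemma proportional_touching:
  fixes x y :: "'v \<Rightarrow> real"
  assumes "finite V" "V \<noteq> {}" "\<And>v. v \<in> V \<Longrightarrow> 0 < x v"
  obtains t v0 where "v0 \<in> V" "y v0 = t * x v0" "\<And>v. v \<in> V \<Longrightarrow> t * x v \<le> y v"
proof -
  define t where "t = Min ((\<lambda>v. y v / x v) ` V)"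
  have "t \<in> (\<lambda>v. y v / x v) ` V" unfolding t_def using assms by (intro Min_in) auto
  then obtain v0 where "v0 \<in> V" "t = y v0 / x v0" by blast
  moreover from this have "y v0 = t * x v0" using assms(3)[of v0] by simp
  moreover have "t * x v \<le> y v" if "v \<in> V" for v
  proof -
    have "t \<le> y v / x v" unfolding t_def using assms that by (intro Min_le) auto
    then show ?thesis using assms(3)[OF that] by (simp add: field_simps)
  qed
  ultimately show ?thesis using that by blast
qed

section \<open>Commuting nonnegative matrices whose supports are jointly connected\<close>

locale commuting_matrices =
  fixes V :: "'v set" and I :: "'i set" and a :: "'i \<Rightarrow> 'v \<Rightarrow> 'v \<Rightarrow> real"
  assumes fin_V: "finite V" and V_ne: "V \<noteq> {}" and fin_I: "finite I"
    and nonneg: "\<And>i v w. 0 \<le> a i v w"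
    and commute: "\<And>i j v w. \<lbrakk>i \<in> I; j \<in> I; v \<in> V; w \<in> V\<rbrakk> \<Longrightarrow>
      (\<Sum>u\<in>V. a i v u * a j u w) = (\<Sum>u\<in>V. a j v u * a i u w)"
    and connected: "\<And>v w. \<lbrakk>v \<in> V; w \<in> V\<rbrakk> \<Longrightarrow>
      (v, w) \<in> {(p, q). p \<in> V \<and> q \<in> V \<and> (\<exists>i\<in>I. 0 < a i p q)}\<^sup>*"
begin

definition adjacency :: "('v \<times> 'v) set" where
  "adjacency = {(p, q). p \<in> V \<and> q \<in> V \<and> (\<exists>i\<in>I. 0 < a i p q)}"

lemma adjacency_iff: "(p, q) \<in> adjacency \<longleftrightarrow> p \<in> V \<and> q \<in> V \<and> (\<exists>i\<in>I. 0 < a i p q)"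
  by (simp add: adjacency_def)

lemma adjacency_rtrancl: "\<lbrakk>v \<in> V; w \<in> V\<rbrakk> \<Longrightarrow> (v, w) \<in> adjacency\<^sup>*"
  unfolding adjacency_def by (rule connected)

definition app :: "'i \<Rightarrow> ('v \<Rightarrow> real) \<Rightarrow> 'v \<Rightarrow> real" where
  "app i f v = (if v \<in> V then \<Sum>w\<in>V. a i v w * f w else 0)"

text \<open>The identity summand lets a walk wait, so the n-th power sees all walks of length at
  most n and periodicity is no obstacle to strict positivity.\<close>

definition walk_op :: "('v \<Rightarrow> real) \<Rightarrow> 'v \<Rightarrow> real" where
  "walk_op f v = (if v \<in> V then f v else 0) + (\<Sum>i\<in>I. app i f v)"

lemma app_linear: "app i (\<lambda>v. s * f v + t * g v) = (\<lambda>v. s * app i f v + t * app i g v)"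
  by (auto simp: app_def fun_eq_iff sum_distrib_left sum.distrib algebra_simps)

lemma walk_op_linear:
  "walk_op (\<lambda>v. s * f v + t * g v) = (\<lambda>v. s * walk_op f v + t * walk_op g v)"
  by (auto simp: walk_op_def app_linear fun_eq_iff sum_distrib_left sum.distrib algebra_simps)

lemma app_app_commute:
  assumes "i \<in> I" "j \<in> I"
  shows "app i (app j f) = app j (app i f)"
proof
  fix v
  have *: "app i (app j f) v = (\<Sum>w\<in>V. (\<Sum>u\<in>V. a i v u * a j u w) * f w)" if "v \<in> V" for i j
    using that unfolding app_def
    by (simp add: sum_distrib_left sum_distrib_right mult.assoc cong: sum.cong) (rule sum.swap)
  show "app i (app j f) v = app j (app i f) v"
  proof (cases "v \<in> V")
    case True
    then show ?thesis using commute[OF assms True] by (simp add: * cong: sum.cong)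
  qed (simp add: app_def)
qed

lemma app_sum: "app i (\<lambda>v. \<Sum>j\<in>J. f j v) v = (\<Sum>j\<in>J. app i (f j) v)"
  by (simp add: app_def sum_distrib_left) (rule impI, rule sum.swap)

lemma app_cong: "(\<And>v. v \<in> V \<Longrightarrow> f v = g v) \<Longrightarrow> app i f = app i g"
  by (auto simp: app_def fun_eq_iff cong: sum.cong)

lemma app_walk_op_commute:
  assumes "i \<in> I"
  shows "app i (walk_op f) = walk_op (app i f)"
proof
  fix v
  have "app i (walk_op f) = app i (\<lambda>v. 1 * f v + 1 * (\<Sum>j\<in>I. app j f v))"
    by (rule app_cong) (simp add: walk_op_def)
  then have "app i (walk_op f) v = app i (\<lambda>v. 1 * f v + 1 * (\<Sum>j\<in>I. app j f v)) v"
    by (rule fun_cong)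
  also have "\<dots> = app i f v + (\<Sum>j\<in>I. app i (app j f) v)"
    by (subst app_linear) (simp add: app_sum)
  finally have "app i (walk_op f) v = app i f v + (\<Sum>j\<in>I. app i (app j f) v)" .
  also have "(\<Sum>j\<in>I. app i (app j f) v) = (\<Sum>j\<in>I. app j (app i f) v)"
    using app_app_commute[OF assms] by (intro sum.cong) auto
  also have "app i f v + \<dots> = walk_op (app i f) v"
    by (simp add: walk_op_def) (simp add: app_def)
  finally show "app i (walk_op f) v = walk_op (app i f) v" .
qed

lemma app_nonneg: "(\<And>v. v \<in> V \<Longrightarrow> 0 \<le> f v) \<Longrightarrow> 0 \<le> app i f v"
  by (auto simp: app_def nonneg intro!: sum_nonneg mult_nonneg_nonneg)

lemma walk_op_ge:
  assumes "\<And>v. v \<in> V \<Longrightarrow> 0 \<le> f v" "v \<in> V"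
  shows "f v \<le> walk_op f v"
    and "\<lbrakk>i \<in> I; w \<in> V\<rbrakk> \<Longrightarrow> a i v w * f w \<le> walk_op f v"
proof -
  have nn: "0 \<le> app i f v" for i using assms app_nonneg by blast
  then have "0 \<le> (\<Sum>i\<in>I. app i f v)" by (simp add: sum_nonneg)
  then show "f v \<le> walk_op f v" using assms by (simp add: walk_op_def)
  assume "i \<in> I" "w \<in> V"
  have "a i v w * f w \<le> app i f v"
    unfolding app_def using assms \<open>w \<in> V\<close> fin_V
    by (auto intro!: member_le_sum[of w V "\<lambda>w. a i v w * f w"] simp: nonneg)
  also have "\<dots> \<le> (\<Sum>i\<in>I. app i f v)"
    using \<open>i \<in> I\<close> fin_I nn by (intro member_le_sum) auto
  also have "\<dots> \<le> walk_op f v" using assms by (simp add: walk_op_def)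
  finally show "a i v w * f w \<le> walk_op f v" .
qed

lemma walk_op_pow_nonneg:
  assumes "\<And>v. v \<in> V \<Longrightarrow> 0 \<le> f v"
  shows "v \<in> V \<Longrightarrow> 0 \<le> (walk_op ^^ n) f v"
proof (induction n arbitrary: v)
  case (Suc n)
  then show ?case using walk_op_ge(1)[of "(walk_op ^^ n) f" v] by fastforce
qed (use assms in simp)

text \<open>Positivity at \<open>w\<close> travels backwards along a walk from \<open>v\<close> to
  \<open>w\<close>: each application of \<open>walk_op\<close> either uses the first edge of the
  walk or, once the remaining length is 0, waits.\<close>

lemma walk_op_pow_pos:
  assumes f: "\<And>v. v \<in> V \<Longrightarrow> 0 \<le> f v" and w: "w \<in> V" "0 < f w"
    and v: "v \<in> V" "(v, w) \<in> adjacency ^^ m" "m \<le> n"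
  shows "0 < (walk_op ^^ n) f v"
  using v
proof (induction n arbitrary: v m)
  case 0
  then show ?case using w by simp
next
  case (Suc n)
  let ?g = "(walk_op ^^ n) f"
  have "0 \<le> ?g v" if "v \<in> V" for v using walk_op_pow_nonneg f that by blast
  note ge = walk_op_ge[of ?g v, OF this Suc.prems(1)]
  show ?case
  proof (cases m)
    case 0
    then have "0 < ?g v" using Suc.IH[of v 0] Suc.prems by simp
    then show ?thesis using ge(1) by simp
  next
    case (Suc m')
    with Suc.prems(2) have "(v, w) \<in> adjacency ^^ Suc m'" by simp
    then obtain u where u: "(v, u) \<in> adjacency" "(u, w) \<in> adjacency ^^ m'"
      by (blast dest: relpow_Suc_D2)
    then obtain i where i: "i \<in> I" "u \<in> V" "0 < a i v u" unfolding adjacency_iff by blast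
    have "0 < ?g u" using Suc.IH[of u m'] u i Suc Suc.prems by simp
    then have "0 < a i v u * ?g u" using i by simp
    then show ?thesis using ge(2)[of i u] i by simp
  qed
qed

text \<open>Let \<open>x\<close> be a positive eigenvector of \<open>K\<close> with eigenvalue
  \<open>c\<close>. As \<open>app i\<close> commutes with \<open>K\<close>, \<open>app i x\<close>
  is again a \<open>c\<close>-eigenvector, and so is \<open>z\<close>, its difference from the
  largest multiple of \<open>x\<close> below it. A positive entry of \<open>z\<close> would force
  \<open>K z v0 > 0\<close> at the touching vertex \<open>v0\<close>, where
  \<open>K z v0 = c * z v0 = 0\<close>.\<close>

lemma common_positive_eigenvector:
  "\<exists>x c. (\<forall>v\<in>V. 0 < x v) \<and> (\<forall>i\<in>I. \<forall>v\<in>V. (\<Sum>w\<in>V. a i v w * x w) = c i * x v)"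
proof -
  have "\<exists>m. \<forall>v\<in>V. \<forall>w\<in>V. \<exists>l\<le>m. (v, w) \<in> adjacency ^^ l"
  proof -
    have "\<forall>p\<in>V \<times> V. \<exists>l. p \<in> adjacency ^^ l"
      by (intro ballI) (metis SigmaE adjacency_rtrancl rtrancl_imp_relpow)
    then obtain l where l: "\<And>p. p \<in> V \<times> V \<Longrightarrow> p \<in> adjacency ^^ l p"
      using bchoice[of "V \<times> V" "\<lambda>p l. p \<in> adjacency ^^ l"] by blast
    have "l p \<le> Max (l ` (V \<times> V))" if "p \<in> V \<times> V" for p
      using that fin_V by (intro Max_ge) auto
    with l have "\<exists>n\<le>Max (l ` (V \<times> V)). (v, w) \<in> adjacency ^^ n" if "v \<in> V" "w \<in> V" for v w
      using that by blast
    then show ?thesis by blast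
  qed
  then obtain m where m: "\<And>v w. \<lbrakk>v \<in> V; w \<in> V\<rbrakk> \<Longrightarrow> \<exists>l\<le>m. (v, w) \<in> adjacency ^^ l" by blast
  \<comment> \<open>The exponent \<open>m\<close> would suffice for positivity; one more application
    guarantees that \<open>K f\<close> vanishes off \<open>V\<close> even if \<open>m\<close> is
    0.\<close>
  define K where "K = walk_op ^^ Suc m"
  have supp: "K f v = 0" if "v \<notin> V" for f v
    using that by (simp add: K_def walk_op_def app_def)
  have lin: "K (\<lambda>v. s * f v + t * g v) = (\<lambda>v. s * K f v + t * K g v)" for s t f g
  proof -
    have "(walk_op ^^ n) (\<lambda>v. s * f v + t * g v) =
        (\<lambda>v. s * (walk_op ^^ n) f v + t * (walk_op ^^ n) g v)" for n
      by (induction n) (simp_all add: walk_op_linear)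
    then show ?thesis by (simp only: K_def)
  qed
  have pos: "0 < K f v" if "\<forall>u\<in>V. 0 \<le> f u" "w \<in> V" "0 < f w" "v \<in> V" for f v w
  proof -
    from m[OF that(4,2)] obtain l where "l \<le> m" "(v, w) \<in> adjacency ^^ l" by (elim exE conjE)
    then show ?thesis unfolding K_def using that walk_op_pow_pos[of f w v l "Suc m"] by auto
  qed
  have cont_walk: "continuous_on UNIV walk_op"
  proof (rule continuous_on_coordinatewise_then_product)
    fix v
    show "continuous_on UNIV (\<lambda>f. walk_op f v)"
      by (cases "v \<in> V") (auto simp: walk_op_def app_def intro!: continuous_intros)
  qed
  have "continuous_on UNIV (walk_op ^^ n)" for n
  proof (induction n)
    case (Suc n)
    then have "continuous_on UNIV (\<lambda>f. walk_op ((walk_op ^^ n) f))"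
      by (rule continuous_on_compose2[OF cont_walk]) simp
    then show ?case by (simp add: o_def)
  qed (simp add: continuous_on_id id_def)
  then have cont: "continuous_on UNIV K" unfolding K_def .
  have "\<exists>x c. (\<forall>v\<in>V. 0 < x v) \<and> K x = (\<lambda>v. c * x v)"
  proof (rule strictly_positive_operator_eigenvector[where K = K and V = V])
    show "K (\<lambda>v. s * f v + t * g v) = (\<lambda>v. s * K f v + t * K g v)" for s t f g by (rule lin)
    show "K f v = 0" if "v \<notin> V" for f v using that by (rule supp)
    show "0 < K f v" if "\<forall>u\<in>V. 0 \<le> f u" "w \<in> V" "0 < f w" "v \<in> V" for f v w
      using that by (rule pos)
  qed (fact fin_V V_ne cont)+
  then obtain x c where x: "\<And>v. v \<in> V \<Longrightarrow> 0 < x v" and Kx: "K x = (\<lambda>v. c * x v)" by blast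
  have "\<exists>t. \<forall>v\<in>V. (\<Sum>w\<in>V. a i v w * x w) = t * x v" if i: "i \<in> I" for i
  proof -
    obtain t v0 where t: "v0 \<in> V" "app i x v0 = t * x v0" "\<And>v. v \<in> V \<Longrightarrow> t * x v \<le> app i x v"
      using proportional_touching[of V x "app i x", OF fin_V V_ne x] by blast
    define z where "z = (\<lambda>v. 1 * app i x v + (- t) * x v)"
    have "K (app i x) = app i (K x)"
    proof -
      have "(walk_op ^^ n) (app i x) = app i ((walk_op ^^ n) x)" for n
        by (induction n) (simp_all add: app_walk_op_commute[OF i])
      then show ?thesis by (simp only: K_def)
    qed
    also have "\<dots> = (\<lambda>v. c * app i x v)" using app_linear[of i c x 0 x] by (simp add: Kx)
    finally have Kz: "K z = (\<lambda>v. c * z v)"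
      unfolding z_def lin by (simp add: Kx algebra_simps)
    have "z v = 0" if v: "v \<in> V" for v
    proof (rule ccontr)
      assume "z v \<noteq> 0"
      then have "0 < z v" using t(3)[OF v] by (simp add: z_def)
      then have "0 < K z v0" using pos[of z v v0] v t by (auto simp: z_def)
      then show False using t by (simp add: Kz) (simp add: z_def)
    qed
    then show ?thesis by (auto simp: z_def app_def)
  qed
  then have "\<exists>c. \<forall>i\<in>I. \<forall>v\<in>V. (\<Sum>w\<in>V. a i v w * x w) = c i * x v"
    by (intro bchoice) blast
  then show ?thesis using x by blast
qed

text \<open>The zero set of \<open>z = y - t * x\<close> contains the touching vertex and is closed
  under adjacency: if \<open>z p = 0\<close>, the nonnegative terms \<open>a i p w * z w\<close> add
  up to \<open>c i * z p = 0\<close>, so \<open>z\<close> vanishes at every neighbour of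
  \<open>p\<close>. Connectedness does the rest.\<close>

lemma positive_eigenvector_unique:
  assumes x: "\<And>v. v \<in> V \<Longrightarrow> 0 < x v"
    and ex: "\<And>i v. \<lbrakk>i \<in> I; v \<in> V\<rbrakk> \<Longrightarrow> (\<Sum>w\<in>V. a i v w * x w) = c i * x v"
    and ey: "\<And>i v. \<lbrakk>i \<in> I; v \<in> V\<rbrakk> \<Longrightarrow> (\<Sum>w\<in>V. a i v w * y w) = c i * y v"
  shows "\<exists>t. \<forall>v\<in>V. y v = t * x v"
proof -
  obtain t v0 where t: "v0 \<in> V" "y v0 = t * x v0" "\<And>v. v \<in> V \<Longrightarrow> t * x v \<le> y v"
    using proportional_touching[of V x, OF fin_V V_ne x] by metis
  define z where "z v = y v - t * x v" for v
  have z: "0 \<le> z v" if "v \<in> V" for v using t that by (simp add: z_def)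
  have step: "z q = 0" if "z p = 0" "(p, q) \<in> adjacency" for p q
  proof -
    from that obtain i where i: "i \<in> I" "0 < a i p q" "p \<in> V" "q \<in> V"
      unfolding adjacency_iff by blast
    have "(\<Sum>w\<in>V. a i p w * z w) = (\<Sum>w\<in>V. a i p w * y w) - t * (\<Sum>w\<in>V. a i p w * x w)"
      by (simp add: z_def right_diff_distrib sum_subtractf sum_distrib_left mult_ac)
    also have "\<dots> = c i * z p" using ex ey i by (simp add: z_def algebra_simps)
    finally have "(\<Sum>w\<in>V. a i p w * z w) = 0" using that by simp
    then have "a i p q * z q = 0"
      using sum_nonneg_eq_0_iff[of V "\<lambda>w. a i p w * z w"] fin_V z nonneg i by auto
    then show ?thesis using i by simp
  qed
  have "z v = 0" if "v \<in> V" for v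
    using adjacency_rtrancl[OF t(1) that]
    by (induction rule: rtrancl_induct) (use t step in \<open>auto simp: z_def\<close>)
  then show ?thesis by (auto simp: z_def)
qed

end

text \<open>The vector \<open>x\<close> puts \<open>c\<close> into the spectrum. Conversely, in the
  weighted sup norm with weights \<open>1 / x i\<close> the operator norm of \<open>A\<close> is at
  most \<open>c\<close>, which bounds every complex eigenvalue. The argument covers reducible
  matrices.\<close>

lemma spectral_radius_eq_positive_eigenvalue:
  fixes A :: "complex mat" and a :: "nat \<Rightarrow> nat \<Rightarrow> real"
  assumes n: "0 < n" and A: "A = Matrix.mat n n (\<lambda>(i, j). complex_of_real (a i j))"
    and nonneg: "\<And>i j. 0 \<le> a i j" and x: "\<And>i. i < n \<Longrightarrow> 0 < x i"
    and ex: "\<And>i. i < n \<Longrightarrow> (\<Sum>j<n. a i j * x j) = c * x i"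
  shows "spectral_radius A = c"
proof -
  have car: "A \<in> carrier_mat n n" by (simp add: A)
  have mv: "(A *\<^sub>v z) $ i = (\<Sum>j<n. complex_of_real (a i j) * z $ j)"
    if "i < n" "z \<in> carrier_vec n" for i z
    using that by (auto simp: A scalar_prod_def atLeast0LessThan intro!: sum.cong)
  \<comment> \<open>The spectral radius is a maximum of norms; nonnegativity makes \<open>c\<close>
    its own norm.\<close>
  have c: "0 \<le> c"
  proof -
    have "0 \<le> (\<Sum>j<n. a 0 j * x j)"
      using nonneg x by (intro sum_nonneg mult_nonneg_nonneg) (auto intro: less_imp_le)
    then have "0 \<le> c * x 0" using ex[OF n] by simp
    then show ?thesis using x[OF n] by (simp add: zero_le_mult_iff)
  qed
  have "eigenvalue A (complex_of_real c)"
  proof -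
    define z where "z = Matrix.vec n (\<lambda>i. complex_of_real (x i))"
    have "A *\<^sub>v z = complex_of_real c \<cdot>\<^sub>v z"
    proof (rule eq_vecI)
      fix i assume "i < dim_vec (complex_of_real c \<cdot>\<^sub>v z)"
      then have i: "i < n" by (simp add: z_def)
      have "(A *\<^sub>v z) $ i = complex_of_real (\<Sum>j<n. a i j * x j)"
        using i by (subst mv) (auto simp: z_def)
      then show "(A *\<^sub>v z) $ i = (complex_of_real c \<cdot>\<^sub>v z) $ i"
        using i by (simp add: ex z_def)
    qed (use car in \<open>simp add: z_def\<close>)
    moreover have "z \<noteq> 0\<^sub>v n"
    proof
      assume "z = 0\<^sub>v n"
      then have "z $ 0 = 0" using n by simp
      then show False using n x[OF n] by (simp add: z_def)
    qed
    ultimately have "eigenvector A z (complex_of_real c)"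
      using car by (simp add: eigenvector_def z_def)
    then show ?thesis unfolding eigenvalue_def by blast
  qed
  then have "c \<in> norm ` spectrum A"
    using c by (auto simp: spectrum_def image_iff intro!: exI[of _ "complex_of_real c"])
  then have "c \<le> spectral_radius A" by (rule spectral_radius_mem_max(2)[OF car n])
  moreover have "spectral_radius A \<le> c"
  proof -
    obtain ev where ev: "eigenvalue A ev" "spectral_radius A = norm ev"
      using spectral_radius_mem_max(1)[OF car n] by (auto simp: spectrum_def)
    then obtain z where z: "z \<in> carrier_vec n" "z \<noteq> 0\<^sub>v n" "A *\<^sub>v z = ev \<cdot>\<^sub>v z"
      using car by (auto simp: eigenvalue_def eigenvector_def)
    \<comment> \<open>The weighted sup norm of the eigenvector \<open>z\<close>; evaluating
      \<open>A z\<close> at an index \<open>i0\<close> where it is attained gives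
      \<open>norm ev * t \<le> c * t\<close>.\<close>
    define t where "t = Max ((\<lambda>i. norm (z $ i) / x i) ` {..<n})"
    have "t \<in> (\<lambda>i. norm (z $ i) / x i) ` {..<n}"
      unfolding t_def using n by (intro Max_in) auto
    then obtain i0 where i0: "i0 < n" "t = norm (z $ i0) / x i0" by auto
    have le: "norm (z $ i) \<le> t * x i" if "i < n" for i
    proof -
      have "norm (z $ i) / x i \<le> t" unfolding t_def using that by (intro Max_ge) auto
      then show ?thesis using x[OF that] by (simp add: field_simps)
    qed
    have "0 < t"
    proof (rule ccontr)
      assume "\<not> 0 < t"
      then have "norm (z $ i) = 0" if "i < n" for i
        using le[OF that] x[OF that] mult_nonpos_nonneg[of t "x i"] norm_ge_zero[of "z $ i"]
        by linarith
      then have "z = 0\<^sub>v n" using z(1) by (intro eq_vecI) auto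
      then show False using z by simp
    qed
    have "norm ev * (t * x i0) = norm ((A *\<^sub>v z) $ i0)"
      using z i0 x[OF i0(1)] by (simp add: norm_mult)
    also have "\<dots> \<le> (\<Sum>j<n. norm (complex_of_real (a i0 j) * z $ j))"
      using mv[OF i0(1) z(1)] by (simp add: norm_sum)
    also have "\<dots> \<le> (\<Sum>j<n. a i0 j * (t * x j))"
      using nonneg le by (intro sum_mono) (auto simp: norm_mult intro!: mult_left_mono)
    also have "\<dots> = t * (\<Sum>j<n. a i0 j * x j)" by (simp add: sum_distrib_left mult_ac)
    also have "\<dots> = c * (t * x i0)" using ex[OF i0(1)] by simp
    finally have "norm ev \<le> c" using \<open>0 < t\<close> x[OF i0(1)] by simp
    then show ?thesis using ev by simp
  qed
  ultimately show ?thesis by simp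
qed

section \<open>The Perron--Frobenius eigenvector of a k-graph\<close>

lemma is_PF_eigenvectorD:
  assumes "is_PF_eigenvector k \<Lambda> x"
  shows "v \<notin> vertices \<Lambda> \<Longrightarrow> x v = 0" "v \<in> vertices \<Lambda> \<Longrightarrow> 0 < x v"
    "(\<Sum>v\<in>vertices \<Lambda>. x v) = 1"
    "\<lbrakk>i \<in> {1..k}; v \<in> vertices \<Lambda>\<rbrakk> \<Longrightarrow>
      (\<Sum>w\<in>vertices \<Lambda>. real (vertex_matrix \<Lambda> i v w) * x w) = rho \<Lambda> i * x v"
  using assms unfolding is_PF_eigenvector_def by blast+

text \<open>The empty category is strongly connected vacuously but has no Perron-Frobenius
  eigenvector, an empty sum not being 1; hence \<open>nonempty\<close>.\<close>

locale strongly_connected_k_graph =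
  fixes k :: nat and \<Lambda> :: "'a graded_category"
  assumes kgraph: "k_graph k \<Lambda>" and finite_graph: "finite_k_graph k \<Lambda>"
    and strongly: "strongly_connected \<Lambda>" and nonempty: "vertices \<Lambda> \<noteq> {}"
begin

abbreviation V :: "'a set" where "V \<equiv> vertices \<Lambda>"
abbreviation A :: "nat \<Rightarrow> 'a \<Rightarrow> 'a \<Rightarrow> nat" where "A \<equiv> vertex_matrix \<Lambda>"

lemma cat: "small_category \<Lambda>" and degf: "degree_functor k \<Lambda>" and
  fact_prop: "factorization_property k \<Lambda>"
  using kgraph by (auto simp: k_graph_def)

lemma unit_degree_mem: "i \<in> {1..k} \<Longrightarrow> unit_degree i \<in> multidegrees k"
  by (auto simp: unit_degree_def multidegrees_def)

lemma finite_vertices: "finite V"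
  using finite_graph by (auto simp: vertices_def finite_k_graph_def multidegrees_def)

lemma finite_edges: "i \<in> {1..k} \<Longrightarrow> finite (mor_of_degree \<Lambda> (unit_degree i))"
  using finite_graph unit_degree_mem by (auto simp: finite_k_graph_def)

lemma range_source_vertices:
  assumes "f \<in> mor \<Lambda>"
  shows "range_of \<Lambda> f \<in> V" "source_of \<Lambda> f \<in> V"
  using assms cat vertices_eq_identities(1)[OF kgraph] by (auto simp: small_category_def)

lemma comp_props:
  assumes "f \<in> mor \<Lambda>" "g \<in> mor \<Lambda>" "source_of \<Lambda> f = range_of \<Lambda> g"
  shows "comp \<Lambda> f g \<in> mor \<Lambda>" "range_of \<Lambda> (comp \<Lambda> f g) = range_of \<Lambda> f"
    "source_of \<Lambda> (comp \<Lambda> f g) = source_of \<Lambda> g"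
    "deg \<Lambda> (comp \<Lambda> f g) = (\<lambda>i. deg \<Lambda> f i + deg \<Lambda> g i)"
  using assms cat degf by (auto simp: small_category_def degree_functor_def)

lemma factorize:
  assumes "f \<in> mor \<Lambda>" "m \<in> multidegrees k" "n \<in> multidegrees k" "deg \<Lambda> f = (\<lambda>i. m i + n i)"
  shows "\<exists>!p. fst p \<in> mor \<Lambda> \<and> snd p \<in> mor \<Lambda> \<and> source_of \<Lambda> (fst p) = range_of \<Lambda> (snd p) \<and>
    f = comp \<Lambda> (fst p) (snd p) \<and> deg \<Lambda> (fst p) = m \<and> deg \<Lambda> (snd p) = n"
  using fact_prop[unfolded factorization_property_def, rule_format, OF assms]
  unfolding case_prod_unfold .

text \<open>Unique factorization makes composition a bijection from composable pairs of edges of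
  degrees \<open>e_i\<close> and \<open>e_j\<close> onto the morphisms of degree
  \<open>e_i + e_j\<close>. That degree is symmetric in \<open>i\<close> and \<open>j\<close>, which
  is why the vertex matrices commute.\<close>

lemma vertex_matrix_product:
  assumes i: "i \<in> {1..k}" and j: "j \<in> {1..k}"
  shows "(\<Sum>u\<in>V. A i v u * A j u w) =
    card {f \<in> mor \<Lambda>. deg \<Lambda> f = (\<lambda>l. unit_degree i l + unit_degree j l) \<and>
      range_of \<Lambda> f = v \<and> source_of \<Lambda> f = w}" (is "_ = card ?F")
proof -
  define X where "X u = {f \<in> mor_of_degree \<Lambda> (unit_degree i). range_of \<Lambda> f = v \<and> source_of \<Lambda> f = u}" for u
  define Y where "Y u = {f \<in> mor_of_degree \<Lambda> (unit_degree j). range_of \<Lambda> f = u \<and> source_of \<Lambda> f = w}" for u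
  have fin: "finite (X u)" "finite (Y u)" for u
    using finite_edges i j by (auto simp: X_def Y_def)
  have "bij_betw (\<lambda>p. comp \<Lambda> (fst p) (snd p)) (\<Union>u\<in>V. X u \<times> Y u) ?F"
  proof (rule bij_betw_imageI)
    let ?Q = "\<lambda>f p. fst p \<in> mor \<Lambda> \<and> snd p \<in> mor \<Lambda> \<and>
      source_of \<Lambda> (fst p) = range_of \<Lambda> (snd p) \<and> f = comp \<Lambda> (fst p) (snd p) \<and>
      deg \<Lambda> (fst p) = unit_degree i \<and> deg \<Lambda> (snd p) = unit_degree j"
    have PQ: "?Q (comp \<Lambda> (fst p) (snd p)) p" and
      PF: "comp \<Lambda> (fst p) (snd p) \<in> ?F" if "p \<in> (\<Union>u\<in>V. X u \<times> Y u)" for p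
      using that by (auto simp: X_def Y_def mor_of_degree_def comp_props)
    have ex1: "\<exists>!p. ?Q f p" if "f \<in> ?F" for f
      using that factorize[of f "unit_degree i" "unit_degree j"] unit_degree_mem i j by auto
    show "inj_on (\<lambda>p. comp \<Lambda> (fst p) (snd p)) (\<Union>u\<in>V. X u \<times> Y u)"
    proof (rule inj_onI)
      fix p q assume p: "p \<in> (\<Union>u\<in>V. X u \<times> Y u)" and q: "q \<in> (\<Union>u\<in>V. X u \<times> Y u)"
        and eq: "comp \<Lambda> (fst p) (snd p) = comp \<Lambda> (fst q) (snd q)"
      note unique = the1_equality[OF ex1[OF PF[OF p]]]
      have "?Q (comp \<Lambda> (fst p) (snd p)) q" using PQ[OF q] eq by simp
      then show "p = q" by (rule trans[OF sym[OF unique[OF PQ[OF p]]] unique])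
    qed
    show "(\<lambda>p. comp \<Lambda> (fst p) (snd p)) ` (\<Union>u\<in>V. X u \<times> Y u) = ?F"
    proof (intro equalityI subsetI)
      fix f assume f: "f \<in> ?F"
      then obtain p where p: "?Q f p" using ex1 by blast
      then have "range_of \<Lambda> (fst p) = v" "source_of \<Lambda> (snd p) = w"
        using f comp_props(2,3)[of "fst p" "snd p"] by auto
      then have "p \<in> X (source_of \<Lambda> (fst p)) \<times> Y (source_of \<Lambda> (fst p))"
        using p by (auto simp: X_def Y_def mor_of_degree_def mem_Times_iff)
      moreover have "source_of \<Lambda> (fst p) \<in> V" using p range_source_vertices by simp
      ultimately have "p \<in> (\<Union>u\<in>V. X u \<times> Y u)" by (rule UN_I[rotated])
      moreover have "f = comp \<Lambda> (fst p) (snd p)" using p by simp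
      ultimately show "f \<in> (\<lambda>p. comp \<Lambda> (fst p) (snd p)) ` (\<Union>u\<in>V. X u \<times> Y u)"
        by (rule rev_image_eqI)
    next
      fix f assume "f \<in> (\<lambda>p. comp \<Lambda> (fst p) (snd p)) ` (\<Union>u\<in>V. X u \<times> Y u)"
      then show "f \<in> ?F" by (elim imageE) (simp only: PF)
    qed
  qed
  then have "card ?F = card (\<Union>u\<in>V. X u \<times> Y u)" by (simp add: bij_betw_same_card)
  also have "\<dots> = (\<Sum>u\<in>V. card (X u \<times> Y u))"
    using finite_vertices fin by (intro card_UN_disjoint) (auto simp: X_def)
  also have "\<dots> = (\<Sum>u\<in>V. A i v u * A j u w)"
    by (simp add: card_cartesian_product vertex_matrix_def X_def Y_def)
  finally show ?thesis by simp
qed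

text \<open>Factorization splits off one edge at a time, and the total degree drops. This turns
  strong connectivity, a statement about morphisms, into walks along nonzero matrix entries.\<close>

lemma morphism_walk:
  assumes "f \<in> mor \<Lambda>"
  shows "(range_of \<Lambda> f, source_of \<Lambda> f) \<in>
    {(p, q). p \<in> V \<and> q \<in> V \<and> (\<exists>i\<in>{1..k}. 0 < real (A i p q))}\<^sup>*" (is "_ \<in> ?R\<^sup>*")
  using assms
proof (induction "\<Sum>i\<in>{1..k}. deg \<Lambda> f i" arbitrary: f rule: less_induct)
  case less
  have deg: "deg \<Lambda> f \<in> multidegrees k" using less.prems degf by (auto simp: degree_functor_def)
  show ?case
  proof (cases "\<exists>i\<in>{1..k}. 0 < deg \<Lambda> f i")
    case False
    then have "deg \<Lambda> f = (\<lambda>i. 0)" using deg by (auto simp: multidegrees_def fun_eq_iff)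
    then have "f \<in> V" using less.prems by (simp add: vertices_def mor_of_degree_def)
    then have "range_of \<Lambda> f = f" "source_of \<Lambda> f = f"
      using vertices_eq_identities[OF kgraph] by auto
    then show ?thesis by simp
  next
    case True
    then obtain i where i: "i \<in> {1..k}" "0 < deg \<Lambda> f i" by blast
    \<comment> \<open>Truncated subtraction loses nothing, since \<open>deg \<Lambda> f i\<close> is
      positive.\<close>
    define n where "n j = deg \<Lambda> f j - unit_degree i j" for j
    have n: "n \<in> multidegrees k" "deg \<Lambda> f = (\<lambda>j. unit_degree i j + n j)"
      using deg i by (auto simp: n_def multidegrees_def unit_degree_def fun_eq_iff)
    obtain \<alpha> \<beta> where ab: "\<alpha> \<in> mor \<Lambda>" "\<beta> \<in> mor \<Lambda>" "source_of \<Lambda> \<alpha> = range_of \<Lambda> \<beta>"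
      "f = comp \<Lambda> \<alpha> \<beta>" "deg \<Lambda> \<alpha> = unit_degree i" "deg \<Lambda> \<beta> = n"
      using factorize[OF less.prems unit_degree_mem[OF i(1)] n] by auto
    have "(\<Sum>j\<in>{1..k}. deg \<Lambda> \<beta> j) < (\<Sum>j\<in>{1..k}. deg \<Lambda> f j)"
      using i by (intro sum_strict_mono_ex1) (auto simp: ab(6) n_def unit_degree_def)
    then have "(range_of \<Lambda> \<beta>, source_of \<Lambda> \<beta>) \<in> ?R\<^sup>*" using less.hyps ab by blast
    moreover have "\<alpha> \<in> {f \<in> mor_of_degree \<Lambda> (unit_degree i).
        range_of \<Lambda> f = range_of \<Lambda> \<alpha> \<and> source_of \<Lambda> f = range_of \<Lambda> \<beta>}"
      using ab by (simp add: mor_of_degree_def)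
    then have "0 < A i (range_of \<Lambda> \<alpha>) (range_of \<Lambda> \<beta>)"
      unfolding vertex_matrix_def using finite_edges[OF i(1)] by (subst card_gt_0_iff) auto
    then have "(range_of \<Lambda> \<alpha>, range_of \<Lambda> \<beta>) \<in> ?R"
      using ab range_source_vertices i by auto
    ultimately show ?thesis using comp_props[of \<alpha> \<beta>] ab
      by (auto intro: converse_rtrancl_into_rtrancl)
  qed
qed

sublocale commuting_matrices V "{1..k}" "\<lambda>i v w. real (A i v w)"
proof
  fix i j v w assume "i \<in> {1..k}" "j \<in> {1..k}" "v \<in> V" "w \<in> V"
  then have "(\<Sum>u\<in>V. A i v u * A j u w) = (\<Sum>u\<in>V. A j v u * A i u w)"
    by (simp add: vertex_matrix_product add.commute)
  then have "real (\<Sum>u\<in>V. A i v u * A j u w) = real (\<Sum>u\<in>V. A j v u * A i u w)" by simp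
  then show "(\<Sum>u\<in>V. real (A i v u) * real (A j u w)) = (\<Sum>u\<in>V. real (A j v u) * real (A i u w))"
    by simp
next
  fix v w assume "v \<in> V" "w \<in> V"
  then obtain f where "f \<in> mor \<Lambda>" "range_of \<Lambda> f = v" "source_of \<Lambda> f = w"
    using strongly unfolding strongly_connected_def by blast
  then show "(v, w) \<in> {(p, q). p \<in> V \<and> q \<in> V \<and> (\<exists>i\<in>{1..k}. 0 < real (A i p q))}\<^sup>*"
    using morphism_walk by blast
qed (use finite_vertices nonempty in auto)

lemma rho_eq_positive_eigenvalue:
  assumes x: "\<And>v. v \<in> V \<Longrightarrow> 0 < x v"
    and ex: "\<And>v. v \<in> V \<Longrightarrow> (\<Sum>w\<in>V. real (A i v w) * x w) = c * x v"
  shows "rho \<Lambda> i = c"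
proof -
  let ?e = "from_nat_into V"
  have e: "?e j \<in> V" for j by (rule from_nat_into[OF nonempty])
  have "rho \<Lambda> i = spectral_radius (Matrix.mat (card V) (card V)
      (\<lambda>(a, b). complex_of_real (real (A i (?e a) (?e b)))))"
    by (simp add: rho_def)
  also have "\<dots> = c"
  proof (rule spectral_radius_eq_positive_eigenvalue)
    show "0 < card V" using finite_vertices nonempty by (simp add: card_gt_0_iff)
    show "(\<Sum>b<card V. real (A i (?e a) (?e b)) * x (?e b)) = c * x (?e a)" for a
      using ex[OF e[of a]] sum.card_from_nat_into[of "\<lambda>w. real (A i (?e a) w) * x w" V] by simp
  qed (use x e in auto)
  finally show ?thesis .
qed

lemma ex_PF_eigenvector: "\<exists>x. is_PF_eigenvector k \<Lambda> x"
proof -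
  obtain x c where x: "\<And>v. v \<in> V \<Longrightarrow> 0 < x v"
    and ex: "\<And>i v. \<lbrakk>i \<in> {1..k}; v \<in> V\<rbrakk> \<Longrightarrow> (\<Sum>w\<in>V. real (A i v w) * x w) = c i * x v"
    using common_positive_eigenvector by blast
  define s where "s = (\<Sum>v\<in>V. x v)"
  have s: "0 < s" unfolding s_def using finite_vertices nonempty x by (intro sum_pos) auto
  define y where "y v = (if v \<in> V then x v / s else 0)" for v
  have "is_PF_eigenvector k \<Lambda> y"
    unfolding is_PF_eigenvector_def
  proof (intro conjI ballI allI impI)
    have "(\<Sum>v\<in>V. y v) = (\<Sum>v\<in>V. x v / s)" by (rule sum.cong) (auto simp: y_def)
    then show "(\<Sum>v\<in>V. y v) = 1" using s by (simp add: sum_divide_distrib[symmetric] s_def[symmetric])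
    fix i v assume iv: "i \<in> {1..k}" "v \<in> V"
    have "rho \<Lambda> i = c i" using rho_eq_positive_eigenvalue x ex iv by blast
    moreover have "(\<Sum>w\<in>V. real (A i v w) * y w) = (\<Sum>w\<in>V. real (A i v w) * x w) / s"
      by (auto simp: y_def sum_divide_distrib intro!: sum.cong)
    ultimately show "(\<Sum>w\<in>V. real (A i v w) * y w) = rho \<Lambda> i * y v"
      using ex[OF iv] iv by (simp add: y_def)
  qed (use s x in \<open>auto simp: y_def\<close>)
  then show ?thesis by blast
qed

lemma PF_eigenvector_unique:
  assumes "is_PF_eigenvector k \<Lambda> x" "is_PF_eigenvector k \<Lambda> y"
  shows "x = y"
proof -
  note x = is_PF_eigenvectorD[OF assms(1)] and y = is_PF_eigenvectorD[OF assms(2)]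
  obtain t where t: "\<And>v. v \<in> V \<Longrightarrow> y v = t * x v"
    using positive_eigenvector_unique[of x "rho \<Lambda>" y] x y by blast
  then have "(\<Sum>v\<in>V. y v) = t * (\<Sum>v\<in>V. x v)" by (simp add: sum_distrib_left)
  then have "t = 1" using x y by simp
  then show ?thesis using t x(1) y(1) by (metis ext mult_1)
qed

lemma kappa_PF: "is_PF_eigenvector k \<Lambda> (kappa k \<Lambda>)"
  unfolding kappa_def using ex_PF_eigenvector PF_eigenvector_unique by (metis theI)

lemmas kappa = is_PF_eigenvectorD[OF kappa_PF]

end

section \<open>The Perron--Frobenius measure\<close>

lemma rho_product_0: "rho_product k \<Lambda> 0 = 1"
  by (simp add: rho_product_def)

text \<open>Passing from \<open>n\<close> to \<open>Suc n\<close> raises the exponent of a single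
  factor. The case split concerns the end of a period, where the remainder returns to 0 and the
  quotient increases.\<close>

lemma rho_product_Suc:
  assumes "1 \<le> k"
  shows "rho_product k \<Lambda> (Suc n) = rho_product k \<Lambda> n * rho \<Lambda> (n mod k + 1)"
proof -
  define q t where "q = n div k" and "t = n mod k"
  have t: "t < k" using assms by (simp add: t_def)
  show ?thesis
  proof (cases "Suc t = k")
    case True
    then have "Suc n mod k = 0" "Suc n div k = Suc q"
      by (simp_all add: mod_Suc div_Suc q_def t_def)
    then have "rho_product k \<Lambda> (Suc n) = (\<Prod>i\<in>{1..k}. rho \<Lambda> i ^ Suc q)"
      by (simp add: rho_product_def)
    also have "{1..k} = insert k {1..t}" using True by auto
    also have "(\<Prod>i\<in>\<dots>. rho \<Lambda> i ^ Suc q) = rho \<Lambda> k ^ Suc q * (\<Prod>i\<in>{1..t}. rho \<Lambda> i ^ Suc q)"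
      using True by (subst prod.insert) auto
    finally have "rho_product k \<Lambda> (Suc n) =
        rho \<Lambda> k ^ Suc q * (\<Prod>i\<in>{1..t}. rho \<Lambda> i ^ Suc q)" .
    moreover have "{t + 1..k} = {k}" using True by auto
    ultimately show ?thesis
      using True by (simp add: rho_product_def Let_def q_def[symmetric] t_def[symmetric])
  next
    case False
    then have "Suc n mod k = Suc t" "Suc n div k = q"
      using assms by (simp_all add: mod_Suc div_Suc q_def t_def)
    then have "rho_product k \<Lambda> (Suc n) =
        (\<Prod>i\<in>{1..Suc t}. rho \<Lambda> i ^ (q + 1)) * (\<Prod>i\<in>{Suc t + 1..k}. rho \<Lambda> i ^ q)"
      by (simp add: rho_product_def)
    moreover have "{1..Suc t} = insert (Suc t) {1..t}" "{t + 1..k} = insert (Suc t) {Suc t + 1..k}"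
      using t by auto
    ultimately show ?thesis
      by (simp add: rho_product_def Let_def q_def[symmetric] t_def[symmetric] del: Icc_eq_Icc)
  qed
qed

section \<open>Cylinder sets as a generating intersection-stable family\<close>

lemma initial_segment_eq_iff:
  "initial_segment x n = initial_segment y n \<longleftrightarrow>
    edge_range (x 0) = edge_range (y 0) \<and> (\<forall>j<n. x j = y j)"
  by (auto simp: initial_segment_def)

lemma initial_segment_eq_path_iff:
  "initial_segment x (path_length \<eta>) = \<eta> \<longleftrightarrow>
    edge_range (x 0) = fst \<eta> \<and> (\<forall>j<path_length \<eta>. x j = snd \<eta> ! j)"
proof -
  have "map x [0..<n] = es \<longleftrightarrow> (\<forall>j<n. x j = es ! j)" if "n = length es" for n es
    unfolding that by (subst list_eq_iff_nth_eq) simp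
  then show ?thesis by (cases \<eta>) (simp add: initial_segment_def path_length_def)
qed

lemma path_length_initial_segment [simp]: "path_length (initial_segment x n) = n"
  by (simp add: path_length_def initial_segment_def)

lemma mem_cylinder_initial_segment:
  "y \<in> cylinder k \<Lambda> (initial_segment x n) \<longleftrightarrow>
    y \<in> infinite_paths k \<Lambda> \<and> initial_segment y n = initial_segment x n"
  by (simp add: cylinder_def)

lemma mem_cylinderD: "x \<in> cylinder k \<Lambda> \<eta> \<Longrightarrow> \<eta> = initial_segment x (path_length \<eta>)"
  by (simp add: cylinder_def)

lemma cylinder_antimono:
  "m \<le> n \<Longrightarrow> cylinder k \<Lambda> (initial_segment x n) \<subseteq> cylinder k \<Lambda> (initial_segment x m)"
  by (auto simp: mem_cylinder_initial_segment initial_segment_eq_iff)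

lemma cylinder_subset: "cylinder k \<Lambda> \<eta> \<subseteq> infinite_paths k \<Lambda>"
  by (auto simp: cylinder_def)

lemma edge_level_iff:
  "e \<in> edge_level k \<Lambda> (Suc n) \<longleftrightarrow> edge_range e \<in> vertices \<Lambda> \<and> edge_source e \<in> vertices \<Lambda> \<and>
    snd (snd e) < vertex_matrix \<Lambda> (n mod k + 1) (edge_range e) (edge_source e)"
  by (cases e) (auto simp: edge_level_def edge_range_def edge_source_def)

lemma infinite_pathsD:
  assumes "x \<in> infinite_paths k \<Lambda>"
  shows "x j \<in> edge_level k \<Lambda> (Suc j)" "edge_source (x j) = edge_range (x (Suc j))"
    "edge_range (x j) \<in> vertices \<Lambda>" "edge_source (x j) \<in> vertices \<Lambda>"
proof -
  show "x j \<in> edge_level k \<Lambda> (Suc j)" "edge_source (x j) = edge_range (x (Suc j))"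
    using assms unfolding infinite_paths_def by blast+
  then show "edge_range (x j) \<in> vertices \<Lambda>" "edge_source (x j) \<in> vertices \<Lambda>"
    by (auto simp: edge_level_iff)
qed

lemma initial_segment_finite_path:
  assumes "x \<in> infinite_paths k \<Lambda>"
  shows "initial_segment x n \<in> finite_paths k \<Lambda>"
  using infinite_pathsD[OF assms]
  by (auto simp: initial_segment_def finite_paths_def hd_map)

lemma path_source_initial_segment:
  assumes "x \<in> infinite_paths k \<Lambda>"
  shows "path_source (initial_segment x n) = edge_range (x n)"
  using infinite_pathsD(2)[OF assms]
  by (cases n) (auto simp: path_source_def initial_segment_def)

text \<open>The empty set is adjoined because disjoint cylinders would otherwise spoil stability
  under intersection.\<close>

definition cylinder_sets ::
    "nat \<Rightarrow> ('a, 'b) graded_category_scheme \<Rightarrow> (nat \<Rightarrow> 'a edge) set set" where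
  "cylinder_sets k \<Lambda> = insert {} (cylinder k \<Lambda> ` finite_paths k \<Lambda>)"

lemma cylinder_sets_Pow: "cylinder_sets k \<Lambda> \<subseteq> Pow (infinite_paths k \<Lambda>)"
  using cylinder_subset by (fastforce simp: cylinder_sets_def)

text \<open>A common point \<open>x\<close> presents both cylinders as initial segments of the same
  path, so they are nested and the longer segment wins.\<close>

lemma cylinder_Int:
  assumes "x \<in> cylinder k \<Lambda> \<eta>" "x \<in> cylinder k \<Lambda> \<zeta>"
  shows "cylinder k \<Lambda> \<eta> \<inter> cylinder k \<Lambda> \<zeta> =
    cylinder k \<Lambda> (initial_segment x (max (path_length \<eta>) (path_length \<zeta>)))"
  by (subst mem_cylinderD[OF assms(1)], subst mem_cylinderD[OF assms(2)])
    (auto simp: mem_cylinder_initial_segment initial_segment_eq_iff less_max_iff_disj)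

lemma Int_stable_cylinder_sets: "Int_stable (cylinder_sets k \<Lambda>)"
proof (rule Int_stableI)
  fix A B assume A: "A \<in> cylinder_sets k \<Lambda>" and B: "B \<in> cylinder_sets k \<Lambda>"
  show "A \<inter> B \<in> cylinder_sets k \<Lambda>"
  proof (cases "A \<inter> B = {}")
    case False
    then obtain x where x: "x \<in> A" "x \<in> B" by blast
    then obtain \<eta> \<zeta> where "A = cylinder k \<Lambda> \<eta>" "B = cylinder k \<Lambda> \<zeta>"
      using A B by (auto simp: cylinder_sets_def)
    with x have "A \<inter> B = cylinder k \<Lambda> (initial_segment x (max (path_length \<eta>) (path_length \<zeta>)))"
      using cylinder_Int by metis
    moreover have "x \<in> infinite_paths k \<Lambda>" using x A cylinder_sets_Pow by blast
    ultimately show ?thesis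
      by (simp add: cylinder_sets_def initial_segment_finite_path)
  qed (simp add: cylinder_sets_def)
qed

text \<open>Induction over the generation of the topology; for a finite intersection the larger of
  the two depths works. Together with countability of the finite paths this places open sets in the
  sigma-algebra of the cylinders.\<close>

lemma open_contains_cylinder:
  assumes "openin (path_topology k \<Lambda>) U"
  shows "U \<subseteq> infinite_paths k \<Lambda> \<and> (\<forall>x\<in>U. \<exists>n. cylinder k \<Lambda> (initial_segment x n) \<subseteq> U)"
proof -
  have "generate_topology_on (cylinder k \<Lambda> ` finite_paths k \<Lambda>) U"
    using assms unfolding path_topology_def by (rule openin_topology_generated_by)
  then show ?thesis
  proof induction
    case (Int A B)
    have "\<exists>n. cylinder k \<Lambda> (initial_segment x n) \<subseteq> A \<inter> B" if "x \<in> A \<inter> B" for x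
    proof -
      from that Int.IH obtain m n where "cylinder k \<Lambda> (initial_segment x m) \<subseteq> A"
        "cylinder k \<Lambda> (initial_segment x n) \<subseteq> B" by blast
      then show ?thesis
        using cylinder_antimono[of m "max m n" k \<Lambda> x] cylinder_antimono[of n "max m n" k \<Lambda> x]
        by (intro exI[of _ "max m n"]) auto
    qed
    then show ?case using Int.IH by blast
  next
    case (UN K)
    then show ?case by (meson Sup_least UnionE Union_upper order_trans)
  next
    case (Basis S)
    then obtain \<eta> where S: "S = cylinder k \<Lambda> \<eta>" by blast
    then have "cylinder k \<Lambda> (initial_segment x (path_length \<eta>)) = S" if "x \<in> S" for x
      using that mem_cylinderD by metis
    then show ?case using S cylinder_subset by blast
  qed simp
qed

lemma countable_finite_paths:
  assumes "finite (vertices \<Lambda>)"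
  shows "countable (finite_paths k \<Lambda>)"
proof (rule countable_subset)
  let ?E = "vertices \<Lambda> \<times> vertices \<Lambda> \<times> (UNIV :: nat set)"
  have "set es \<subseteq> ?E" if "\<forall>j<length es. es ! j \<in> edge_level k \<Lambda> (Suc j)" for es
  proof
    fix e assume "e \<in> set es"
    then obtain j where "j < length es" "e = es ! j" by (auto simp: in_set_conv_nth)
    then have "e \<in> edge_level k \<Lambda> (Suc j)" using that by simp
    then show "e \<in> ?E" by (auto simp: edge_level_def)
  qed
  then show "finite_paths k \<Lambda> \<subseteq> vertices \<Lambda> \<times> lists ?E"
    unfolding finite_paths_def by (auto simp: in_lists_conv_set subset_iff)
  show "countable (vertices \<Lambda> \<times> lists ?E)"
    using countable_finite[OF assms] by (intro countable_SIGMA countable_lists) auto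
qed

text \<open>Such a \<open>U\<close> is the union of all cylinders inside it, and there are only
  countably many. Applied to open sets and later to balls.\<close>

lemma sigma_sets_cylinder_setsI:
  assumes "finite (vertices \<Lambda>)" and U: "U \<subseteq> infinite_paths k \<Lambda>"
    and loc: "\<And>x. x \<in> U \<Longrightarrow> \<exists>n. cylinder k \<Lambda> (initial_segment x n) \<subseteq> U"
  shows "U \<in> sigma_sets (infinite_paths k \<Lambda>) (cylinder_sets k \<Lambda>)"
proof -
  define H where "H = {\<eta> \<in> finite_paths k \<Lambda>. cylinder k \<Lambda> \<eta> \<subseteq> U}"
  have "U = \<Union>(cylinder k \<Lambda> ` H)"
  proof (intro equalityI subsetI)
    fix x assume x: "x \<in> U"
    then obtain n where n: "cylinder k \<Lambda> (initial_segment x n) \<subseteq> U" using loc by blast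
    have "x \<in> infinite_paths k \<Lambda>" using x U by blast
    then have "initial_segment x n \<in> H" "x \<in> cylinder k \<Lambda> (initial_segment x n)"
      using n initial_segment_finite_path by (auto simp: H_def mem_cylinder_initial_segment)
    then show "x \<in> \<Union>(cylinder k \<Lambda> ` H)" by blast
  qed (auto simp: H_def)
  also have "\<dots> \<in> sigma_sets (infinite_paths k \<Lambda>) (cylinder_sets k \<Lambda>)"
  proof (rule sigma_sets_UNION)
    show "countable (cylinder k \<Lambda> ` H)"
      unfolding H_def
      by (rule countable_image, rule countable_subset[OF _ countable_finite_paths[OF assms(1)]]) blast
  qed (auto simp: H_def cylinder_sets_def intro: sigma_sets.Basic)
  finally show ?thesis .
qed

lemma sigma_sets_path_topology:
  assumes "finite (vertices \<Lambda>)"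
  shows "sigma_sets (infinite_paths k \<Lambda>) {U. openin (path_topology k \<Lambda>) U} =
    sigma_sets (infinite_paths k \<Lambda>) (cylinder_sets k \<Lambda>)"
proof (rule sigma_sets_eqI)
  fix U assume "U \<in> {U. openin (path_topology k \<Lambda>) U}"
  then show "U \<in> sigma_sets (infinite_paths k \<Lambda>) (cylinder_sets k \<Lambda>)"
    using open_contains_cylinder by (intro sigma_sets_cylinder_setsI assms) blast+
next
  fix U assume "U \<in> cylinder_sets k \<Lambda>"
  then have "openin (path_topology k \<Lambda>) U"
    by (auto simp: cylinder_sets_def path_topology_def intro: topology_generated_by_Basis)
  then show "U \<in> sigma_sets (infinite_paths k \<Lambda>) {U. openin (path_topology k \<Lambda>) U}"
    by (intro sigma_sets.Basic) simp
qed

lemma is_PF_measure_unique: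
  assumes fin: "finite (vertices \<Lambda>)" and M: "is_PF_measure k \<Lambda> M" and N: "is_PF_measure k \<Lambda> N"
  shows "M = N"
proof -
  interpret M: prob_space M using M by (simp add: is_PF_measure_def)
  interpret N: prob_space N using N by (simp add: is_PF_measure_def)
  \<comment> \<open>The cylinders of the length-zero paths serve as the countable cover by sets of
    finite measure that uniqueness on an intersection-stable generator asks for.\<close>
  let ?A = "cylinder k \<Lambda> ` {\<eta> \<in> finite_paths k \<Lambda>. path_length \<eta> = 0}"
  show ?thesis
  proof (rule measure_eqI_generator_eq_countable[OF Int_stable_cylinder_sets cylinder_sets_Pow])
    show "sets M = sigma_sets (infinite_paths k \<Lambda>) (cylinder_sets k \<Lambda>)"
      "sets N = sigma_sets (infinite_paths k \<Lambda>) (cylinder_sets k \<Lambda>)"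
      using M N sigma_sets_path_topology[OF fin] by (simp_all add: is_PF_measure_def)
    show "emeasure M X = emeasure N X" if "X \<in> cylinder_sets k \<Lambda>" for X
      using that M N
      by (auto simp: cylinder_sets_def is_PF_measure_def M.emeasure_eq_measure N.emeasure_eq_measure)
    show "?A \<subseteq> cylinder_sets k \<Lambda>" by (auto simp: cylinder_sets_def)
    show "\<Union>?A = infinite_paths k \<Lambda>"
    proof (intro equalityI subsetI)
      fix x assume x: "x \<in> infinite_paths k \<Lambda>"
      then have "x \<in> cylinder k \<Lambda> (initial_segment x 0)"
        by (simp add: mem_cylinder_initial_segment)
      then show "x \<in> \<Union>?A"
        by (rule UN_I[rotated]) (use initial_segment_finite_path[OF x] in simp)
    qed (use cylinder_subset in blast)
    show "countable ?A"
      by (rule countable_image, rule countable_subset[OF _ countable_finite_paths[OF fin]]) blast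
  qed simp
qed

section \<open>A random walk whose law is the Perron-Frobenius measure\<close>

locale expanding_k_graph = strongly_connected_k_graph k \<Lambda>
  for k :: nat and \<Lambda> :: "'a graded_category" +
  assumes k_pos: "1 \<le> k" and rho_gt_1: "\<And>i. \<lbrakk>1 \<le> i; i \<le> k\<rbrakk> \<Longrightarrow> 1 < rho \<Lambda> i"
begin

abbreviation \<kappa> :: "'a \<Rightarrow> real" where "\<kappa> \<equiv> kappa k \<Lambda>"
abbreviation P :: "nat \<Rightarrow> real" where "P \<equiv> rho_product k \<Lambda>"
abbreviation \<rho> :: "nat \<Rightarrow> real" where "\<rho> n \<equiv> rho \<Lambda> (n mod k + 1)"

lemma index_bounds: "n mod k + 1 \<in> {1..k}"
  using k_pos by (auto simp: Suc_le_eq)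

lemma \<rho>_gt_1: "1 < \<rho> n"
  using rho_gt_1 index_bounds[of n] by simp

lemma P_Suc: "P (Suc n) = P n * \<rho> n"
  by (rule rho_product_Suc[OF k_pos])

lemma P_pos: "0 < P n"
proof (induction n)
  case (Suc n)
  then show ?case using \<rho>_gt_1[of n] by (simp add: P_Suc del: One_nat_def)
qed (simp add: rho_product_0)

text \<open>
  Step \<open>0\<close> chooses the starting vertex \<open>u\<close>, encoded as the source of a fictitious edge
  \<open>(u, u, 0)\<close>; step \<open>Suc n\<close> chooses the edge with index \<open>n\<close>.  One independent choice is made for
  every step and every vertex \<open>v\<close>, of which the random walk uses only the one at its current
  vertex; the clauses for \<open>v \<notin> V\<close> merely keep all factors probability spaces.
\<close>

fun step_space :: "nat \<Rightarrow> 'a \<Rightarrow> 'a edge set" where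
  "step_space 0 v = (\<lambda>u. (u, u, 0)) ` V"
| "step_space (Suc n) v =
    (if v \<in> V then {e \<in> edge_level k \<Lambda> (Suc n). edge_range e = v} else {(v, v, 0)})"

text \<open>For \<open>v \<in> V\<close> the second clause is the Doob transform of
  \<open>A_i / rho_i\<close> by the harmonic vector \<open>kappa\<close>, the mass being shared
  equally among parallel edges.\<close>

fun step_weight :: "nat \<Rightarrow> 'a \<Rightarrow> 'a edge \<Rightarrow> real" where
  "step_weight 0 v e = \<kappa> (edge_source e)"
| "step_weight (Suc n) v e = (if v \<in> V then \<kappa> (edge_source e) / (\<rho> n * \<kappa> v) else 1)"

definition step_measure :: "nat \<times> 'a \<Rightarrow> 'a edge measure" where
  "step_measure i = point_measure (step_space (fst i) (snd i))
    (\<lambda>e. ennreal (step_weight (fst i) (snd i) e))"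

lemma step_space_Suc_eq:
  assumes "v \<in> V"
  shows "step_space (Suc n) v = (\<lambda>(q, m). (v, q, m)) ` (SIGMA q:V. {..<A (n mod k + 1) v q})"
  using assms by (auto simp: edge_level_def edge_range_def image_iff)

lemma finite_step_space: "finite (step_space n v)"
proof (cases n)
  case (Suc m)
  show ?thesis
  proof (cases "v \<in> V")
    case True
    then show ?thesis unfolding Suc step_space_Suc_eq[OF True] using finite_vertices by auto
  qed (simp add: Suc)
qed (simp add: finite_vertices)

lemma step_weight_nonneg: "e \<in> step_space n v \<Longrightarrow> 0 \<le> step_weight n v e"
proof (cases n)
  case 0
  assume "e \<in> step_space n v"
  with 0 show ?thesis using kappa(2) by (auto simp: edge_source_def less_imp_le)
next
  case (Suc m)
  assume "e \<in> step_space n v"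
  with Suc show ?thesis using kappa(2) \<rho>_gt_1[of m]
    by (auto simp: edge_level_iff less_imp_le)
qed

text \<open>At step 0 this is the normalisation of \<open>kappa\<close>; at later steps from
  \<open>v \<in> V\<close> it is the eigenvector equation at \<open>v\<close>, divided by its
  right-hand side.\<close>

lemma sum_step_weight: "(\<Sum>e\<in>step_space n v. step_weight n v e) = 1"
proof (cases n)
  case 0
  have "(\<Sum>e\<in>(\<lambda>u. (u, u, 0 :: nat)) ` V. \<kappa> (edge_source e)) = (\<Sum>u\<in>V. \<kappa> u)"
    by (subst sum.reindex) (auto simp: inj_on_def edge_source_def)
  then show ?thesis by (simp add: 0 kappa(3))
next
  case (Suc m)
  show ?thesis
  proof (cases "v \<in> V")
    case True
    have "(\<Sum>e\<in>step_space n v. \<kappa> (edge_source e)) =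
        (\<Sum>(q, j)\<in>(SIGMA q:V. {..<A (m mod k + 1) v q}). \<kappa> q)"
      unfolding Suc step_space_Suc_eq[OF True]
      by (subst sum.reindex) (auto simp: inj_on_def edge_source_def intro!: sum.cong)
    also have "\<dots> = (\<Sum>q\<in>V. real (A (m mod k + 1) v q) * \<kappa> q)"
      using finite_vertices by (subst sum.Sigma[symmetric]) auto
    also have "\<dots> = \<rho> m * \<kappa> v" using kappa(4)[OF index_bounds True] .
    finally have "(\<Sum>e\<in>step_space n v. \<kappa> (edge_source e)) = \<rho> m * \<kappa> v" .
    then have "(\<Sum>e\<in>step_space n v. \<kappa> (edge_source e) / (\<rho> m * \<kappa> v)) = 1"
      using kappa(2)[OF True] \<rho>_gt_1[of m] by (simp add: sum_divide_distrib[symmetric])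
    then show ?thesis using True by (simp add: Suc)
  qed (simp add: Suc)
qed

lemma prob_space_step_measure: "prob_space (step_measure i)"
  unfolding step_measure_def
  by (intro prob_space_point_measure finite_step_space)
    (simp_all add: sum_ennreal step_weight_nonneg sum_step_weight)

lemma product_prob_space_step: "product_prob_space step_measure"
  by (rule product_prob_spaceI) (rule prob_space_step_measure)

text \<open>No current vertex exists at step 0, so \<open>undefined\<close> fills its place; the law
  of that coordinate does not depend on the second component.\<close>

primrec walk :: "(nat \<times> 'a \<Rightarrow> 'a edge) \<Rightarrow> nat \<Rightarrow> 'a edge" where
  "walk \<omega> 0 = \<omega> (0, undefined)"
| "walk \<omega> (Suc n) = \<omega> (Suc n, edge_source (walk \<omega> n))"

definition walk_path :: "(nat \<times> 'a \<Rightarrow> 'a edge) \<Rightarrow> nat \<Rightarrow> 'a edge" where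
  "walk_path \<omega> n = walk \<omega> (Suc n)"

lemma space_PiM_step_measure:
  "\<omega> \<in> space (PiM UNIV step_measure) \<longleftrightarrow> (\<forall>n v. \<omega> (n, v) \<in> step_space n v)"
proof -
  have "\<omega> \<in> space (PiM UNIV step_measure) \<longleftrightarrow> (\<forall>i. \<omega> i \<in> step_space (fst i) (snd i))"
    by (simp add: space_PiM PiE_UNIV_domain Pi_iff step_measure_def space_point_measure
        del: step_space.simps)
  also have "\<dots> \<longleftrightarrow> (\<forall>n v. \<omega> (n, v) \<in> step_space n v)"
    unfolding split_paired_All by (simp only: fst_conv snd_conv)
  finally show ?thesis .
qed

lemma walk_step:
  assumes "\<omega> \<in> space (PiM UNIV step_measure)"
  shows "edge_source (walk \<omega> n) \<in> V"
    and "walk \<omega> (Suc n) \<in> edge_level k \<Lambda> (Suc n)"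
    and "edge_range (walk \<omega> (Suc n)) = edge_source (walk \<omega> n)"
proof -
  have \<omega>: "\<omega> (n, v) \<in> step_space n v" for n v
    using assms by (simp only: space_PiM_step_measure)
  have suc: "walk \<omega> (Suc n) \<in> edge_level k \<Lambda> (Suc n) \<and>
      edge_range (walk \<omega> (Suc n)) = edge_source (walk \<omega> n)" if "edge_source (walk \<omega> n) \<in> V" for n
    using \<omega>[of "Suc n" "edge_source (walk \<omega> n)"] that by simp
  have V: "edge_source (walk \<omega> n) \<in> V" for n
  proof (induction n)
    case 0
    then show ?case using \<omega>[of 0 undefined] by (auto simp: edge_source_def)
  next
    case (Suc n)
    then show ?case using suc[of n] by (auto simp: edge_level_iff)
  qed
  show "edge_source (walk \<omega> n) \<in> V" by (rule V)
  show "walk \<omega> (Suc n) \<in> edge_level k \<Lambda> (Suc n)"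
    "edge_range (walk \<omega> (Suc n)) = edge_source (walk \<omega> n)"
    using suc[OF V] by auto
qed

lemma walk_path_in_infinite_paths:
  "\<omega> \<in> space (PiM UNIV step_measure) \<Longrightarrow> walk_path \<omega> \<in> infinite_paths k \<Lambda>"
  using walk_step by (simp add: infinite_paths_def walk_path_def del: walk.simps)

text \<open>The path \<open>\<eta>\<close> with its fictitious starting edge prepended, as a value of \<open>walk\<close>.\<close>

definition extended_edge :: "'a fpath \<Rightarrow> nat \<Rightarrow> 'a edge" where
  "extended_edge \<eta> j = (case j of 0 \<Rightarrow> (fst \<eta>, fst \<eta>, 0) | Suc i \<Rightarrow> snd \<eta> ! i)"

text \<open>The coordinate consulted at step \<open>j\<close> by a walk that has followed
  \<open>\<eta>\<close> so far.\<close>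

definition step_index :: "'a fpath \<Rightarrow> nat \<Rightarrow> nat \<times> 'a" where
  "step_index \<eta> j = (j, case j of 0 \<Rightarrow> undefined | Suc i \<Rightarrow> edge_source (extended_edge \<eta> i))"

text \<open>The walk reads coordinates that depend on its own past, but while it follows
  \<open>\<eta>\<close> its current vertex is known. The event thus becomes a condition on finitely
  many fixed coordinates.\<close>

lemma walk_eq_iff:
  "(\<forall>j\<le>n. walk \<omega> j = extended_edge \<eta> j) \<longleftrightarrow> (\<forall>j\<le>n. \<omega> (step_index \<eta> j) = extended_edge \<eta> j)"
proof (induction n)
  case (Suc n)
  have *: "(\<forall>j\<le>Suc n. Q j) \<longleftrightarrow> (\<forall>j\<le>n. Q j) \<and> Q (Suc n)" for Q by (auto simp: le_Suc_eq)
  show ?case unfolding *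
  proof (rule conj_cong[OF Suc.IH])
    assume "\<forall>j\<le>n. \<omega> (step_index \<eta> j) = extended_edge \<eta> j"
    then have "walk \<omega> n = extended_edge \<eta> n" using Suc.IH by blast
    then show "(walk \<omega> (Suc n) = extended_edge \<eta> (Suc n)) =
        (\<omega> (step_index \<eta> (Suc n)) = extended_edge \<eta> (Suc n))"
      by (simp add: step_index_def)
  qed
qed (simp add: step_index_def)

lemma walk_path_cylinder_iff:
  assumes \<omega>: "\<omega> \<in> space (PiM UNIV step_measure)"
  shows "walk_path \<omega> \<in> cylinder k \<Lambda> \<eta> \<longleftrightarrow>
    (\<forall>j\<le>path_length \<eta>. \<omega> (step_index \<eta> j) = extended_edge \<eta> j)"
proof -
  have "walk \<omega> 0 \<in> step_space 0 undefined"
    using \<omega> by (simp only: space_PiM_step_measure walk.simps)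
  \<comment> \<open>The fictitious edge is determined by its source, so the starting vertex of
    \<open>\<eta>\<close> can be treated as one more edge to be matched.\<close>
  then have start: "edge_source (walk \<omega> 0) = v \<longleftrightarrow> walk \<omega> 0 = (v, v, 0)" for v
    by (auto simp: edge_source_def simp del: walk.simps)
  have "walk_path \<omega> \<in> cylinder k \<Lambda> \<eta> \<longleftrightarrow> initial_segment (walk_path \<omega>) (path_length \<eta>) = \<eta>"
    using walk_path_in_infinite_paths[OF \<omega>] by (simp add: cylinder_def)
  also have "\<dots> \<longleftrightarrow> edge_source (walk \<omega> 0) = fst \<eta> \<and>
      (\<forall>j<path_length \<eta>. walk \<omega> (Suc j) = snd \<eta> ! j)"
    by (simp only: initial_segment_eq_path_iff walk_path_def walk_step(3)[OF \<omega>])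
  also have "\<dots> \<longleftrightarrow> (\<forall>j\<le>path_length \<eta>. walk \<omega> j = extended_edge \<eta> j)"
    by (simp add: start less_Suc_eq_le[symmetric] All_less_Suc2 extended_edge_def del: walk.simps)
  finally show ?thesis by (simp only: walk_eq_iff)
qed

text \<open>The factors \<open>kappa\<close> telescope, leaving only the one at the last vertex,
  while the spectral radii in the denominators accumulate to \<open>P n\<close>.\<close>

lemma prod_step_weight:
  assumes \<eta>: "\<eta> \<in> finite_paths k \<Lambda>"
  shows "n \<le> path_length \<eta> \<Longrightarrow>
    extended_edge \<eta> n \<in> step_space n (snd (step_index \<eta> n)) \<and>
    edge_source (extended_edge \<eta> n) \<in> V \<and>
    (\<Prod>j\<le>n. step_weight j (snd (step_index \<eta> j)) (extended_edge \<eta> j)) =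
      inverse (P n) * \<kappa> (edge_source (extended_edge \<eta> n))"
proof (induction n)
  case 0
  then show ?case using \<eta>
    by (auto simp: extended_edge_def finite_paths_def edge_source_def rho_product_0)
next
  case (Suc n)
  let ?e = "extended_edge \<eta>"
  have IH: "edge_source (?e n) \<in> V" "(\<Prod>j\<le>n. step_weight j (snd (step_index \<eta> j)) (?e j)) =
      inverse (P n) * \<kappa> (edge_source (?e n))"
    using Suc by auto
  have lev: "?e (Suc n) \<in> edge_level k \<Lambda> (Suc n)"
    using \<eta> Suc.prems by (auto simp: extended_edge_def finite_paths_def path_length_def)
  have adj: "edge_range (?e (Suc n)) = edge_source (?e n)"
    using \<eta> Suc.prems
    by (cases n) (auto simp: extended_edge_def finite_paths_def path_length_def edge_source_def
        hd_conv_nth)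
  have "(\<Prod>j\<le>Suc n. step_weight j (snd (step_index \<eta> j)) (?e j)) =
      inverse (P n) * \<kappa> (edge_source (?e n)) *
      (\<kappa> (edge_source (?e (Suc n))) / (\<rho> n * \<kappa> (edge_source (?e n))))"
    using IH by (simp add: step_index_def)
  also have "\<dots> = inverse (P (Suc n)) * \<kappa> (edge_source (?e (Suc n)))"
    using kappa(2)[OF IH(1)] P_pos[of n] \<rho>_gt_1[of n] by (simp add: P_Suc field_simps)
  finally show ?case using lev adj IH by (auto simp: step_index_def edge_level_iff)
qed

lemma extended_edge_source:
  "edge_source (extended_edge \<eta> (path_length \<eta>)) = path_source \<eta>"
  by (cases "snd \<eta>" rule: rev_cases)
    (auto simp: extended_edge_def path_length_def path_source_def edge_source_def)

lemma walk_path_cylinder: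
  assumes \<eta>: "\<eta> \<in> finite_paths k \<Lambda>"
  defines "S \<equiv> walk_path -` cylinder k \<Lambda> \<eta> \<inter> space (PiM UNIV step_measure)"
  shows "S \<in> sets (PiM UNIV step_measure)"
    and "measure (PiM UNIV step_measure) S = inverse (P (path_length \<eta>)) * \<kappa> (path_source \<eta>)"
proof -
  interpret product_prob_space step_measure UNIV by (rule product_prob_space_step)
  define n where "n = path_length \<eta>"
  define J where "J = step_index \<eta> ` {..n}"
  define X where "X = (\<lambda>i :: nat \<times> 'a. {extended_edge \<eta> (fst i)})"
  have fst: "fst (step_index \<eta> j) = j" for j by (simp add: step_index_def)
  \<comment> \<open>Different steps consult different coordinates, so the product over
    \<open>J\<close> is a product over the steps.\<close>
  have inj: "inj_on (step_index \<eta>) {..n}" by (rule inj_on_inverseI[of _ fst]) (rule fst)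
  have X: "X i \<in> sets (step_measure i)" if "i \<in> J" for i
    using that prod_step_weight[OF \<eta>]
    by (auto simp: J_def X_def fst step_measure_def sets_point_measure n_def)
  have "S = {\<omega> \<in> space (PiM UNIV step_measure). \<forall>i\<in>J. \<omega> i \<in> X i}"
    unfolding S_def using walk_path_cylinder_iff[of _ \<eta>]
    by (auto simp: J_def X_def fst n_def)
  also have "\<dots> = prod_emb UNIV step_measure J (Pi\<^sub>E J X)"
    unfolding prod_emb_def using X by (auto simp: space_PiM Pi_iff)
  finally have S: "S = prod_emb UNIV step_measure J (Pi\<^sub>E J X)" .
  show "S \<in> sets (PiM UNIV step_measure)"
    unfolding S using X by (intro sets_PiM_I) (auto simp: J_def)
  have "measure (PiM UNIV step_measure) S = (\<Prod>i\<in>J. measure (step_measure i) (X i))"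
    unfolding S using X by (intro measure_PiM_emb) (auto simp: J_def)
  also have "\<dots> = (\<Prod>j\<le>n. measure (step_measure (step_index \<eta> j)) (X (step_index \<eta> j)))"
    unfolding J_def by (subst prod.reindex[OF inj]) simp
  also have "\<dots> = (\<Prod>j\<le>n. step_weight j (snd (step_index \<eta> j)) (extended_edge \<eta> j))"
  proof (rule prod.cong)
    fix j assume "j \<in> {..n}"
    then have "extended_edge \<eta> j \<in> step_space j (snd (step_index \<eta> j))"
      using prod_step_weight[OF \<eta>] by (simp add: n_def)
    then show "measure (step_measure (step_index \<eta> j)) (X (step_index \<eta> j)) =
        step_weight j (snd (step_index \<eta> j)) (extended_edge \<eta> j)"
      unfolding step_measure_def X_def fst
      by (subst measure_point_measure_finite_if)
        (auto simp: finite_step_space step_weight_nonneg)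
  qed simp
  also have "\<dots> = inverse (P n) * \<kappa> (path_source \<eta>)"
    using prod_step_weight[OF \<eta>, of n] by (simp add: n_def extended_edge_source)
  finally show "measure (PiM UNIV step_measure) S =
      inverse (P (path_length \<eta>)) * \<kappa> (path_source \<eta>)"
    by (simp add: n_def)
qed

lemma ex_PF_measure: "\<exists>M. is_PF_measure k \<Lambda> M"
proof -
  interpret product_prob_space step_measure UNIV by (rule product_prob_space_step)
  let ?\<Omega> = "infinite_paths k \<Lambda>"
  define N where "N = sigma ?\<Omega> (cylinder_sets k \<Lambda>)"
  have meas: "walk_path \<in> measurable (PiM UNIV step_measure) N"
    unfolding N_def
  proof (rule measurable_measure_of[OF cylinder_sets_Pow])
    show "walk_path -` Y \<inter> space (PiM UNIV step_measure) \<in> sets (PiM UNIV step_measure)"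
      if "Y \<in> cylinder_sets k \<Lambda>" for Y
      using that walk_path_cylinder(1) by (auto simp: cylinder_sets_def)
  qed (use walk_path_in_infinite_paths in auto)
  have sets: "sets N = sigma_sets ?\<Omega> (cylinder_sets k \<Lambda>)" and space: "space N = ?\<Omega>"
    by (simp_all add: N_def cylinder_sets_Pow)
  let ?M = "distr (PiM UNIV step_measure) N walk_path"
  have "is_PF_measure k \<Lambda> ?M"
    unfolding is_PF_measure_def
  proof (intro conjI ballI)
    show "space ?M = ?\<Omega>" by (simp add: space)
    show "sets ?M = sigma_sets ?\<Omega> {U. openin (path_topology k \<Lambda>) U}"
      by (simp add: sets sigma_sets_path_topology[OF finite_vertices])
    show "prob_space ?M" using meas by (rule P.prob_space_distr)
    fix \<eta> assume \<eta>: "\<eta> \<in> finite_paths k \<Lambda>"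
    then have "cylinder k \<Lambda> \<eta> \<in> sets N" by (auto simp: sets cylinder_sets_def)
    then show "measure ?M (cylinder k \<Lambda> \<eta>) = inverse (P (path_length \<eta>)) * \<kappa> (path_source \<eta>)"
      using measure_distr[OF meas] walk_path_cylinder(2)[OF \<eta>] by simp
  qed
  then show ?thesis by blast
qed

lemma PF_measure: "is_PF_measure k \<Lambda> (PF_measure k \<Lambda>)"
  unfolding PF_measure_def
  using ex_PF_measure is_PF_measure_unique[OF finite_vertices] by (metis theI)

end

section \<open>Volume doubling\<close>

text \<open>A position where the paths differ bounds the lengths of common initial segments, so
  \<open>GREATEST\<close> is meaningful; agreement passes to shorter segments, which gives the
  equivalence.\<close>

lemma meet_characterization:
  assumes "x \<noteq> y" "edge_range (x 0) = edge_range (y 0)"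
  obtains j where "meet x y = Some (initial_segment x j)"
    "\<And>n. initial_segment x n = initial_segment y n \<longleftrightarrow> n \<le> j"
proof -
  let ?Q = "\<lambda>n. initial_segment x n = initial_segment y n"
  define j where "j = (GREATEST n. ?Q n)"
  obtain l where l: "x l \<noteq> y l" using assms by (auto simp: fun_eq_iff)
  have bound: "n \<le> l" if "?Q n" for n
    using that l by (auto simp: initial_segment_eq_iff not_less[symmetric])
  have "?Q 0" using assms by (simp add: initial_segment_eq_iff)
  then have "?Q j" unfolding j_def by (rule GreatestI_nat[of ?Q 0 l]) (rule bound)
  moreover have "n \<le> j" if "?Q n" for n
    unfolding j_def using that bound by (rule Greatest_le_nat[of ?Q n l])
  ultimately have "?Q n \<longleftrightarrow> n \<le> j" for n
    by (auto simp: initial_segment_eq_iff)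
  moreover have "meet x y = Some (initial_segment x j)"
    using assms(2) by (simp add: meet_def j_def)
  ultimately show ?thesis by (intro that)
qed

text \<open>Once \<open>z\<close> agrees with \<open>y\<close> beyond a position where
  \<open>x\<close> and \<open>y\<close> differ, \<open>x\<close> has the same meet with both. This
  serves the measurability of balls.\<close>

lemma path_dist_locally_constant:
  assumes "x \<noteq> y" obtains n where
    "\<And>z. initial_segment z n = initial_segment y n \<Longrightarrow> path_dist k \<Lambda> \<delta> x z = path_dist k \<Lambda> \<delta> x y"
proof -
  obtain l where l: "x l \<noteq> y l" using assms by (auto simp: fun_eq_iff)
  have "path_dist k \<Lambda> \<delta> x z = path_dist k \<Lambda> \<delta> x y"
    if z: "initial_segment z (Suc l) = initial_segment y (Suc l)" for z
  proof -
    have zy: "edge_range (z 0) = edge_range (y 0)" "\<And>j. j \<le> l \<Longrightarrow> z j = y j"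
      using z by (auto simp: initial_segment_eq_iff)
    have "initial_segment x n = initial_segment z n \<longleftrightarrow> initial_segment x n = initial_segment y n" for n
    proof (cases "n \<le> l")
      case True
      then show ?thesis using zy by (simp add: initial_segment_eq_iff)
    next
      case False
      then show ?thesis using zy l by (auto simp: initial_segment_eq_iff)
    qed
    then have "meet x z = meet x y" using zy by (simp add: meet_def)
    moreover have "x \<noteq> z" using zy l by auto
    ultimately show ?thesis using assms by (simp add: path_dist_def)
  qed
  then show ?thesis using that by blast
qed

section \<open>Comparison of balls with cylinders\<close>

context expanding_k_graph
begin

abbreviation \<mu> :: "(nat \<Rightarrow> 'a edge) measure" where "\<mu> \<equiv> PF_measure k \<Lambda>"

definition \<kappa>_min :: real where "\<kappa>_min = Min (\<kappa> ` V)"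
definition \<rho>_max :: real where "\<rho>_max = Max (rho \<Lambda> ` {1..k})"

lemma \<kappa>_min_le: "v \<in> V \<Longrightarrow> \<kappa>_min \<le> \<kappa> v"
  unfolding \<kappa>_min_def using finite_vertices by (intro Min_le) auto

lemma \<kappa>_min_pos: "0 < \<kappa>_min"
  unfolding \<kappa>_min_def using finite_vertices nonempty kappa(2) by (subst Min_gr_iff) auto

lemma \<kappa>_le_1: "v \<in> V \<Longrightarrow> \<kappa> v \<le> 1"
  using member_le_sum[of v V \<kappa>] kappa(2,3) finite_vertices by (simp add: less_imp_le)

lemma \<kappa>_min_le_1: "\<kappa>_min \<le> 1"
  using nonempty \<kappa>_min_le \<kappa>_le_1 by (meson equals0I order_trans)

lemma \<rho>_le_max: "\<rho> n \<le> \<rho>_max"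
  unfolding \<rho>_max_def by (intro Max_ge finite_imageI imageI index_bounds) simp

lemma \<rho>_max_gt_1: "1 < \<rho>_max"
  using \<rho>_gt_1[of 0] \<rho>_le_max[of 0] by (rule less_le_trans)

lemma P_mono: "m \<le> n \<Longrightarrow> P m \<le> P n"
proof (rule lift_Suc_mono_le[of P])
  show "P n \<le> P (Suc n)" for n
    unfolding P_Suc using P_pos[of n] \<rho>_gt_1[of n] by (simp del: One_nat_def)
qed

text \<open>The least of the finitely many spectral radii still exceeds 1, so \<open>P\<close> grows
  at least geometrically.\<close>

lemma P_unbounded: "\<exists>n. b < P n"
proof -
  define r where "r = Min (rho \<Lambda> ` {1..k})"
  have r: "1 < r" unfolding r_def using k_pos rho_gt_1 by (subst Min_gr_iff) auto
  have "r \<le> \<rho> n" for n unfolding r_def by (intro Min_le finite_imageI imageI index_bounds) simp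
  then have "r ^ n \<le> P n" for n
  proof (induction n)
    case (Suc n)
    have "r ^ n * r \<le> P n * \<rho> n"
      using Suc r P_pos[of n] by (intro mult_mono) auto
    then show ?case by (simp only: P_Suc power_Suc2)
  qed (simp add: rho_product_0)
  then show ?thesis using real_arch_pow[OF r, of b] less_le_trans by blast
qed

context
  fixes \<delta> :: real
  assumes \<delta>: "0 < \<delta>"
begin

text \<open>The weight of a path of length \<open>n\<close> stripped of its factor
  \<open>kappa\<close>, which lies between \<open>\<kappa>_min\<close> and 1.\<close>

definition scale :: "nat \<Rightarrow> real" where "scale n = P n powr (- 1 / \<delta>)"

lemma scale_pos: "0 < scale n"
  using P_pos[of n] by (simp add: scale_def)

lemma scale_antimono: "m \<le> n \<Longrightarrow> scale n \<le> scale m"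
  unfolding scale_def using \<delta> P_mono P_pos by (intro powr_mono2') auto

lemma scale_0: "scale 0 = 1"
  by (simp add: scale_def rho_product_0)

lemma scale_powr: "scale n powr \<delta> = inverse (P n)"
  unfolding scale_def powr_powr using \<delta> P_pos[of n] by (simp add: powr_minus)

lemma ex_scale_less:
  assumes "0 < s" shows "\<exists>n. scale n < s"
proof -
  obtain n where "s powr (- \<delta>) < P n" using P_unbounded by blast
  then have "scale n < (s powr (- \<delta>)) powr (- 1 / \<delta>)"
    unfolding scale_def using \<delta> assms by (intro powr_less_mono2_neg) auto
  also have "\<dots> = s" using \<delta> assms by (simp add: powr_powr)
  finally show ?thesis by blast
qed

lemma path_dist_cases:
  assumes x: "x \<in> infinite_paths k \<Lambda>" and "x \<noteq> y"
  obtains (disjoint) "edge_range (x 0) \<noteq> edge_range (y 0)" "path_dist k \<Lambda> \<delta> x y = 1"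
  | (meet) j where "path_dist k \<Lambda> \<delta> x y = scale j * \<kappa> (edge_range (x j))"
    "\<And>n. initial_segment x n = initial_segment y n \<longleftrightarrow> n \<le> j"
proof (cases "edge_range (x 0) = edge_range (y 0)")
  case True
  from meet_characterization[OF assms(2) True] obtain j where
    j: "meet x y = Some (initial_segment x j)"
    "\<And>n. initial_segment x n = initial_segment y n \<longleftrightarrow> n \<le> j" by blast
  have "path_dist k \<Lambda> \<delta> x y = scale j * \<kappa> (edge_range (x j))"
    using assms j(1)
    by (simp add: path_dist_def weight_def scale_def path_source_initial_segment)
  then show ?thesis using j(2) by (rule meet)
next
  case False
  then show ?thesis using assms by (intro disjoint) (auto simp: path_dist_def meet_def)
qed

lemma path_dist_le_1:
  assumes "x \<in> infinite_paths k \<Lambda>"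
  shows "path_dist k \<Lambda> \<delta> x y \<le> 1"
proof (cases "x = y")
  case False
  from assms False show ?thesis
  proof (cases rule: path_dist_cases)
    case (meet j)
    have "scale j * \<kappa> (edge_range (x j)) \<le> 1 * 1"
      using scale_antimono[of 0 j] scale_0 \<kappa>_le_1 kappa(2) infinite_pathsD(3)[OF assms]
      by (intro mult_mono) (auto intro: less_imp_le)
    then show ?thesis using meet by simp
  qed simp
qed (simp add: path_dist_def)

text \<open>Points of the cylinder other than \<open>x\<close> part from \<open>x\<close> at some
  level \<open>j \<ge> n\<close>, hence have distance at most \<open>scale j \<le> scale n\<close>,
  because \<open>kappa\<close> is at most 1.\<close>

lemma cylinder_subset_ball:
  assumes x: "x \<in> infinite_paths k \<Lambda>" and n: "scale n < r"
  shows "cylinder k \<Lambda> (initial_segment x n) \<subseteq> path_ball k \<Lambda> \<delta> x r"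
proof
  fix y assume "y \<in> cylinder k \<Lambda> (initial_segment x n)"
  then have y: "y \<in> infinite_paths k \<Lambda>" "initial_segment x n = initial_segment y n"
    by (auto simp: mem_cylinder_initial_segment)
  have "path_dist k \<Lambda> \<delta> x y < r"
  proof (cases "x = y")
    case True
    then show ?thesis using n scale_pos[of n] by (simp add: path_dist_def)
  next
    case False
    from x False show ?thesis
    proof (cases rule: path_dist_cases)
      case (meet j)
      have "scale j * \<kappa> (edge_range (x j)) \<le> scale j * 1"
        using scale_pos[of j] \<kappa>_le_1 infinite_pathsD(3)[OF x] by (intro mult_left_mono) auto
      also have "\<dots> \<le> scale n" using meet(2) y scale_antimono by simp
      finally show ?thesis using meet(1) n by simp
    qed (use y in \<open>simp add: initial_segment_eq_iff\<close>)
  qed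
  then show "y \<in> path_ball k \<Lambda> \<delta> x r" using y by (simp add: path_ball_def)
qed

text \<open>Parting at level \<open>j\<close> costs at least \<open>scale j * \<kappa>_min\<close>.
  The bound \<open>r \<le> 1\<close> excludes paths with another starting vertex, which have
  distance exactly 1.\<close>

lemma ball_subset_cylinder:
  assumes x: "x \<in> infinite_paths k \<Lambda>" and "r \<le> 1"
    and n: "\<And>j. scale j * \<kappa>_min < r \<Longrightarrow> n \<le> j"
  shows "path_ball k \<Lambda> \<delta> x r \<subseteq> cylinder k \<Lambda> (initial_segment x n)"
proof
  fix y assume "y \<in> path_ball k \<Lambda> \<delta> x r"
  then have y: "y \<in> infinite_paths k \<Lambda>" "path_dist k \<Lambda> \<delta> x y < r" by (auto simp: path_ball_def)
  have "initial_segment x n = initial_segment y n"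
  proof (cases "x = y")
    case False
    from x False show ?thesis
    proof (cases rule: path_dist_cases)
      case (meet j)
      have "scale j * \<kappa>_min \<le> scale j * \<kappa> (edge_range (x j))"
        using scale_pos[of j] \<kappa>_min_le infinite_pathsD(3)[OF x] by (intro mult_left_mono) auto
      then have "n \<le> j" using meet(1) y by (intro n) simp
      then show ?thesis using meet(2) by simp
    qed (use y \<open>r \<le> 1\<close> in simp)
  qed simp
  then show "y \<in> cylinder k \<Lambda> (initial_segment x n)"
    using y by (simp add: mem_cylinder_initial_segment)
qed

lemma PF_measure_props:
  shows "space \<mu> = infinite_paths k \<Lambda>"
    and "sets \<mu> = sigma_sets (infinite_paths k \<Lambda>) (cylinder_sets k \<Lambda>)"
    and "prob_space \<mu>"
  using PF_measure sigma_sets_path_topology[OF finite_vertices] by (simp_all add: is_PF_measure_def)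

lemma measure_cylinder:
  assumes "x \<in> infinite_paths k \<Lambda>"
  shows "measure \<mu> (cylinder k \<Lambda> (initial_segment x n)) = inverse (P n) * \<kappa> (edge_range (x n))"
  using PF_measure initial_segment_finite_path[OF assms] path_source_initial_segment[OF assms]
  by (simp add: is_PF_measure_def)

lemma sets_cylinder:
  "x \<in> infinite_paths k \<Lambda> \<Longrightarrow> cylinder k \<Lambda> (initial_segment x n) \<in> sets \<mu>"
  unfolding PF_measure_props
  by (intro sigma_sets.Basic) (simp add: cylinder_sets_def initial_segment_finite_path)

text \<open>Monotonicity of the measure asks for this in the lower bound, where the ball is the
  larger set. A small cylinder around the centre lies in the ball; away from it the distance to
  \<open>x\<close> is locally constant.\<close>

lemma sets_ball:
  assumes x: "x \<in> infinite_paths k \<Lambda>" and r: "0 < r"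
  shows "path_ball k \<Lambda> \<delta> x r \<in> sets \<mu>"
  unfolding PF_measure_props
proof (rule sigma_sets_cylinder_setsI[OF finite_vertices])
  fix y assume y: "y \<in> path_ball k \<Lambda> \<delta> x r"
  show "\<exists>n. cylinder k \<Lambda> (initial_segment y n) \<subseteq> path_ball k \<Lambda> \<delta> x r"
  proof (cases "x = y")
    case True
    then show ?thesis using ex_scale_less[OF r] cylinder_subset_ball[OF x] by blast
  next
    case False
    from path_dist_locally_constant[OF this, of k \<Lambda> \<delta>]
    obtain n where n: "\<And>z. initial_segment z n = initial_segment y n \<Longrightarrow>
        path_dist k \<Lambda> \<delta> x z = path_dist k \<Lambda> \<delta> x y" by blast
    have "cylinder k \<Lambda> (initial_segment y n) \<subseteq> path_ball k \<Lambda> \<delta> x r"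
    proof
      fix z assume "z \<in> cylinder k \<Lambda> (initial_segment y n)"
      then have "z \<in> infinite_paths k \<Lambda>" "initial_segment z n = initial_segment y n"
        by (simp_all add: mem_cylinder_initial_segment)
      moreover from this(2) have "path_dist k \<Lambda> \<delta> x z = path_dist k \<Lambda> \<delta> x y" by (rule n)
      ultimately show "z \<in> path_ball k \<Lambda> \<delta> x r" using y by (simp add: path_ball_def)
    qed
    then show ?thesis by blast
  qed
qed (auto simp: path_ball_def)

text \<open>The first level \<open>n\<close> with \<open>scale n * \<kappa>_min < s\<close> encloses
  the ball in a cylinder of mass at most \<open>1 / P n = scale n powr \<delta>\<close>. For
  \<open>s > 1\<close> the bound exceeds the total mass; this range is included since the lemma is
  applied to \<open>2 * r\<close>.\<close>

lemma measure_ball_le: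
  assumes x: "x \<in> infinite_paths k \<Lambda>" and s: "0 < s"
  shows "measure \<mu> (path_ball k \<Lambda> \<delta> x s) \<le> (s / \<kappa>_min) powr \<delta>"
proof -
  interpret prob_space \<mu> by (rule PF_measure_props)
  show ?thesis
  proof (cases "s \<le> 1")
    case True
    define n where "n = (LEAST j. scale j < s / \<kappa>_min)"
    have "\<exists>j. scale j < s / \<kappa>_min" using ex_scale_less s \<kappa>_min_pos by simp
    then have n: "scale n < s / \<kappa>_min" unfolding n_def by (rule LeastI_ex)
    have "n \<le> j" if "scale j * \<kappa>_min < s" for j
      unfolding n_def using that \<kappa>_min_pos by (intro Least_le) (simp add: field_simps)
    then have "measure \<mu> (path_ball k \<Lambda> \<delta> x s) \<le> measure \<mu> (cylinder k \<Lambda> (initial_segment x n))"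
      by (intro finite_measure_mono ball_subset_cylinder x True sets_cylinder) auto
    also have "\<dots> \<le> inverse (P n) * 1"
      unfolding measure_cylinder[OF x] using P_pos[of n] \<kappa>_le_1 infinite_pathsD(3)[OF x]
      by (intro mult_left_mono) auto
    also have "\<dots> = scale n powr \<delta>" by (simp add: scale_powr)
    also have "\<dots> \<le> (s / \<kappa>_min) powr \<delta>"
      using n scale_pos[of n] \<delta> by (intro powr_mono2) auto
    finally show ?thesis .
  next
    case False
    then have "1 \<le> s / \<kappa>_min" using \<kappa>_min_pos \<kappa>_min_le_1 by simp
    then have "1 \<le> (s / \<kappa>_min) powr \<delta>" using \<delta> by (intro ge_one_powr_ge_zero) auto
    then show ?thesis using prob_le_1 order_trans by blast
  qed
qed

text \<open>With \<open>n = Suc m\<close> the first level whose scale is below \<open>r\<close>,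
  failure at \<open>m\<close> gives \<open>r powr \<delta> \<le> 1 / P m\<close>. Passing from
  \<open>P m\<close> to \<open>P n\<close> costs at most \<open>\<rho>_max\<close>.\<close>

lemma measure_ball_ge:
  assumes x: "x \<in> infinite_paths k \<Lambda>" and r: "0 < r" "r \<le> 1"
  shows "\<kappa>_min / \<rho>_max * r powr \<delta> \<le> measure \<mu> (path_ball k \<Lambda> \<delta> x r)"
proof -
  interpret prob_space \<mu> by (rule PF_measure_props)
  define n where "n = (LEAST j. scale j < r)"
  have n: "scale n < r" unfolding n_def by (rule LeastI_ex) (rule ex_scale_less[OF r(1)])
  \<comment> \<open>Here \<open>r \<le> 1\<close> enters: \<open>scale 0 = 1\<close> is not below
    \<open>r\<close>, so a preceding level exists.\<close>
  then have "n \<noteq> 0" using r(2) scale_0 by (metis not_less)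
  then obtain m where m: "n = Suc m" by (cases n) auto
  have "\<not> scale m < r" using m not_less_Least[of m "\<lambda>j. scale j < r"] by (simp add: n_def)
  then have "r powr \<delta> \<le> scale m powr \<delta>" using r \<delta> by (intro powr_mono2) auto
  then have rP: "r powr \<delta> \<le> inverse (P m)" by (simp add: scale_powr)
  have "\<kappa>_min / \<rho>_max * r powr \<delta> \<le> \<kappa>_min / \<rho>_max * inverse (P m)"
    using rP \<kappa>_min_pos \<rho>_max_gt_1 by (intro mult_left_mono) auto
  also have "\<dots> \<le> \<kappa> (edge_range (x n)) / \<rho> m * inverse (P m)"
    using P_pos[of m] \<kappa>_min_pos \<rho>_gt_1[of m] \<rho>_le_max[of m]
      \<kappa>_min_le[OF infinite_pathsD(3)[OF x, of n]]
    by (intro mult_right_mono frac_le) auto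
  also have "\<dots> = measure \<mu> (cylinder k \<Lambda> (initial_segment x n))"
    unfolding measure_cylinder[OF x] m P_Suc by (simp add: field_simps)
  also have "\<dots> \<le> measure \<mu> (path_ball k \<Lambda> \<delta> x r)"
    by (intro finite_measure_mono cylinder_subset_ball sets_ball x n r)
  finally show ?thesis .
qed

lemma volume_doubling:
  "\<exists>c>0. \<forall>x\<in>infinite_paths k \<Lambda>. \<forall>r>0.
    measure \<mu> (path_ball k \<Lambda> \<delta> x (2 * r)) \<le> c * measure \<mu> (path_ball k \<Lambda> \<delta> x r)"
proof -
  interpret prob_space \<mu> by (rule PF_measure_props)
  define C where "C = (2 / \<kappa>_min) powr \<delta>"
  \<comment> \<open>The upper bound at radius \<open>2 * r\<close> divided by the lower bound at
    radius \<open>r\<close>.\<close>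
  define c where "c = C * (\<rho>_max / \<kappa>_min)"
  have "1 \<le> 2 / \<kappa>_min" using \<kappa>_min_pos \<kappa>_min_le_1 by simp
  then have C: "1 \<le> C" unfolding C_def using \<delta> by (intro ge_one_powr_ge_zero) auto
  have "1 \<le> \<rho>_max / \<kappa>_min" using \<kappa>_min_pos \<kappa>_min_le_1 \<rho>_max_gt_1 by simp
  then have c: "1 \<le> c" unfolding c_def using C mult_mono[of 1 C 1 "\<rho>_max / \<kappa>_min"] by simp
  have "measure \<mu> (path_ball k \<Lambda> \<delta> x (2 * r)) \<le> c * measure \<mu> (path_ball k \<Lambda> \<delta> x r)"
    if x: "x \<in> infinite_paths k \<Lambda>" and r: "0 < r" for x r
  proof (cases "r \<le> 1")
    case True
    have "measure \<mu> (path_ball k \<Lambda> \<delta> x (2 * r)) \<le> (2 * r / \<kappa>_min) powr \<delta>"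
      using r by (intro measure_ball_le x) auto
    also have "\<dots> = C * r powr \<delta>"
      using powr_mult[of "2 / \<kappa>_min" r \<delta>] r \<kappa>_min_pos by (simp add: C_def)
    also have "\<dots> = c * (\<kappa>_min / \<rho>_max * r powr \<delta>)"
      using \<kappa>_min_pos \<rho>_max_gt_1 by (simp add: c_def)
    also have "\<dots> \<le> c * measure \<mu> (path_ball k \<Lambda> \<delta> x r)"
      using c r True by (intro mult_left_mono measure_ball_ge x) auto
    finally show ?thesis .
  next
    \<comment> \<open>The ball of radius \<open>r > 1\<close> is the whole space, so
      \<open>1 \<le> c\<close> is enough.\<close>
    case False
    then have "path_ball k \<Lambda> \<delta> x r = space \<mu>"
      using path_dist_le_1[OF x]
      by (auto simp: path_ball_def PF_measure_props(1) not_le intro: le_less_trans)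
    then have "measure \<mu> (path_ball k \<Lambda> \<delta> x r) = 1" by (simp add: prob_space)
    then show ?thesis by (simp add: order_trans[OF prob_le_1 c])
  qed
  then show ?thesis using c by (intro exI[of _ c]) auto
qed

end

end

theorem mainTheorem2:
  fixes k :: nat and \<Lambda> :: "'a graded_category" and \<delta> :: real
  assumes "1 \<le> k"
    and "k_graph k \<Lambda>"
    and "finite_k_graph k \<Lambda>"
    and "strongly_connected \<Lambda>"
    and "\<And>i. 1 \<le> i \<Longrightarrow> i \<le> k \<Longrightarrow> 1 < rho \<Lambda> i"
    and "0 < \<delta>" and "\<delta> < 1"
  shows "\<exists>c>0. \<forall>x\<in>infinite_paths k \<Lambda>. \<forall>r>0.
    measure (PF_measure k \<Lambda>) (path_ball k \<Lambda> \<delta> x (2 * r))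
      \<le> c * measure (PF_measure k \<Lambda>) (path_ball k \<Lambda> \<delta> x r)"
proof (cases "vertices \<Lambda> = {}")
  \<comment> \<open>Without vertices there are no infinite paths, and any positive constant
    works.\<close>
  case True
  then have "infinite_paths k \<Lambda> = {}" using infinite_pathsD(3)[of _ k \<Lambda> 0] by blast
  then show ?thesis by (intro exI[of _ 1]) simp
next
  case False
  then interpret expanding_k_graph k \<Lambda>
    using assms by unfold_locales auto
  show ?thesis by (rule volume_doubling[OF \<open>0 < \<delta>\<close>])
qed

end
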